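(* (1) For every $l\in\mathbb N$ and every $\omega>0$, the semiaxis $\Lambda_l^+(\omega)$ contains at least one generalized simple intersection lying in $\partial L_l(\omega)$. (2) For every $l,s\in\mathbb N$ with $l\geq 3$, $s\equiv l\pmod 2$, $0<s<l$, and every $\omega>0$ small enough (depending on $l$), the semiaxis $\Lambda_l^+(\omega)$ intersects each of the two boundary components $\partial L_{s,+}(\omega)$ and $\partial L_{s,-}(\omega)$. (3) For every $l\geq 2$ and every $\omega>0$ small enough, the boundary component $\partial L_{0,+}(\omega)$ intersects $\Lambda_l^+(\omega)$.
   Context: Fix $\omega>0$. For $(B,A)\in\mathbb R^2$ consider $\frac{d\varphi}{dt}=-\sin\varphi+B+A\cos\omega t$. With $\tau=\omega t$, $l=B/\omega$, $\mu=A/(2\omega)$, its solutions are the orbits of the vector field $\dot\varphi=-\frac{\sin\varphi}{\omega}+l+2\mu\cos\tau$, $\dot\tau=1$ on the torus $\mathbb R^2/2\pi\mathbb Z^2$ with coordinates $(\varphi,\tau)$. The rotation number is $\rho(B,A;\omega)=\lim_{k\to+\infty}\varphi(2\pi k)/(2\pi k)$ for any solution $\varphi(\tau)$. For $s\in\mathbb Z$ the phase-lock area is $L_s=L_s(\omega)=\{(B,A):\rho(B,A;\omega)=s\}$. The Poincaré map $h_{(B,A)}$ is the time-$2\pi$ flow map of this vector field acting on the circle $\{\tau=0\}=\mathbb R/2\pi\mathbb Z$. The boundary $\partial L_s$ is the union of two curves $\partial L_{s,\pm}(\omega)$, where $\partial L_{s,\pm}(\omega)$ consists of those points of $L_s$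 for which $h_{(B,A)}$ fixes the point $\pm\frac{\pi}{2}\pmod{2\pi}$. A constriction is a point $(B,A)$ of some $L_s$ with $A\neq0$ at which $h_{(B,A)}$ is the identity. The axis is $\Lambda_l(\omega)=\{B=l\omega\}$ and $\Lambda_l^+(\omega)=\Lambda_l(\omega)\cap\{A\geq0\}$. A generalized simple intersection is a point of intersection of an axis $\Lambda_l(\omega)$ with the boundary $\partial L_s(\omega)$ of a phase-lock area with $s\equiv l\pmod 2$ that is not a constriction. *)

theory Defs
  imports "HOL-Analysis.Analysis"
begin

text \<open>Solutions of the vector field on the torus, lifted to the universal cover:
  d phi / d tau = - sin phi / omega + l + 2 mu cos tau, with l = B/omega, 2 mu = A/omega.\<close>
definition is_sol :: "real \<Rightarrow> real \<Rightarrow> real \<Rightarrow> (real \<Rightarrow> real) \<Rightarrow> bool" where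
  "is_sol \<omega> B A \<phi> \<longleftrightarrow>
     (\<forall>\<tau>. (\<phi> has_real_derivative
              (- sin (\<phi> \<tau>) / \<omega> + B / \<omega> + 2 * (A / (2 * \<omega>)) * cos \<tau>)) (at \<tau>))"

definition rot_num :: "real \<Rightarrow> real \<Rightarrow> real \<Rightarrow> real" where
  "rot_num \<omega> B A = (THE r. \<forall>\<phi>. is_sol \<omega> B A \<phi> \<longrightarrow>
       (\<lambda>k::nat. \<phi> (2 * pi * real k) / (2 * pi * real k)) \<longlonglongrightarrow> r)"

definition phase_lock :: "real \<Rightarrow> int \<Rightarrow> (real \<times> real) set" where
  "phase_lock \<omega> s = {(B, A). rot_num \<omega> B A = of_int s}"

definition poincare_lift :: "real \<Rightarrow> real \<Rightarrow> real \<Rightarrow> real \<Rightarrow> real" where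
  "poincare_lift \<omega> B A x = (THE y. \<exists>\<phi>. is_sol \<omega> B A \<phi> \<and> \<phi> 0 = x \<and> \<phi> (2 * pi) = y)"

definition poincare_fixes :: "real \<Rightarrow> real \<Rightarrow> real \<Rightarrow> real \<Rightarrow> bool" where
  "poincare_fixes \<omega> B A x \<longleftrightarrow> (\<exists>k::int. poincare_lift \<omega> B A x = x + 2 * pi * of_int k)"

definition poincare_is_id :: "real \<Rightarrow> real \<Rightarrow> real \<Rightarrow> bool" where
  "poincare_is_id \<omega> B A \<longleftrightarrow> (\<forall>x. poincare_fixes \<omega> B A x)"

definition bdry_plus :: "real \<Rightarrow> int \<Rightarrow> (real \<times> real) set" where
  "bdry_plus \<omega> s = {(B, A). (B, A) \<in> phase_lock \<omega> s \<and> poincare_fixes \<omega> B A (pi / 2)}"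

definition bdry_minus :: "real \<Rightarrow> int \<Rightarrow> (real \<times> real) set" where
  "bdry_minus \<omega> s = {(B, A). (B, A) \<in> phase_lock \<omega> s \<and> poincare_fixes \<omega> B A (- pi / 2)}"

definition bdry :: "real \<Rightarrow> int \<Rightarrow> (real \<times> real) set" where
  "bdry \<omega> s = bdry_plus \<omega> s \<union> bdry_minus \<omega> s"

definition is_constriction :: "real \<Rightarrow> real \<Rightarrow> real \<Rightarrow> bool" where
  "is_constriction \<omega> B A \<longleftrightarrow>
     (\<exists>s. (B, A) \<in> phase_lock \<omega> s) \<and> A \<noteq> 0 \<and> poincare_is_id \<omega> B A"

definition axis :: "real \<Rightarrow> int \<Rightarrow> (real \<times> real) set" where
  "axis \<omega> l = {(B, A). B = of_int l * \<omega>}"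

definition semiaxis :: "real \<Rightarrow> int \<Rightarrow> (real \<times> real) set" where
  "semiaxis \<omega> l = {(B, A). B = of_int l * \<omega> \<and> A \<ge> 0}"

definition gen_simple_int :: "real \<Rightarrow> int \<Rightarrow> int \<Rightarrow> real \<times> real \<Rightarrow> bool" where
  "gen_simple_int \<omega> l s p \<longleftrightarrow>
     p \<in> axis \<omega> l \<and> p \<in> bdry \<omega> s \<and> s mod 2 = l mod 2 \<and> \<not> is_constriction \<omega> (fst p) (snd p)"

end

theory Submission
  imports Defs "Jordan_Normal_Form.Determinant"
begin

text \<open>With \<open>c = 1/(2\<omega>)\<close>, \<open>m = A/(2\<omega>)\<close> and \<open>b = B/\<omega>\<close> the equation reads
  \<open>\<phi>' = b + 2m cos t - 2c sin \<phi>\<close>. It is invariant under \<open>(\<phi>, t) \<mapsto> (\<pi> - \<phi>, - t)\<close>, so the solution through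
  \<open>\<plusminus>\<pi>/2\<close> is fixed by the Poincare map with rotation number \<open>s\<close> iff it advances by \<open>\<pi>s\<close> in half a
  period. Parts (2) and (3) follow from the intermediate value theorem in \<open>A\<close>: for \<open>A = 0\<close> and
  \<open>l\<omega> < 1\<close> the equilibria confine the solution, while for large \<open>A\<close> averaging yields an advance of at
  least \<open>(l - 1)\<pi>\<close>.

  For part (1) the equation is linearised. For \<open>B = l\<omega>\<close> the linear system has a trigonometric
  polynomial solution as soon as \<open>m\<close> is the Perron eigenvalue of a nonnegative matrix depending on
  \<open>c\<close>; this makes one of the points \<open>\<plusminus>\<pi>/2\<close> fixed. The rotation number is a continuous integer along
  the Perron branch and tends to \<open>l\<close> as \<open>c \<rightarrow> 0\<close>. If the point were a constriction, a second
  periodic solution would exist. Pairing its Fourier coefficients with those of \<open>exp (m (z + 1/z))\<close>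
  times the polynomial shows that \<open>l\<close> consecutive coefficients of this product vanish, which
  contradicts the positivity of a Toeplitz determinant of modified Bessel functions.\<close>

section \<open>The equation on the circle\<close>

text \<open>For \<open>B = l * \<omega>\<close> the conjugate term of the linear system carries the
  integer frequency \<open>l\<close>. Fourier polynomials with exponents 0 to l - 1 then lead to a
  closed eigenvalue problem of size \<open>l\<close>. The Perron eigenvalue is chosen for the
  positivity of its vector, which is used three times: comparing eigenvectors makes the eigenvalue
  continuous in \<open>c\<close>, so that the rotation number can be followed to small
  \<open>c\<close>; the polynomial does not vanish at time 0; and a sign shows that a sequence
  proportional to the eigenvector cannot belong to \<open>- c\<close>. The eigenvector yields only
  one periodic solution, so a constriction has to be excluded separately. Real and imaginary parts
  of Fourier coefficients decouple: the polynomial has real coefficients, whereas a periodic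
  solution through the opposite point would give, as imaginary parts, a bounded sequence satisfying
  the same relation with \<open>- c\<close>. The Wronskian of the two would have positive mean over
  a period, yet this mean sees only the coefficients 0 to l - 1, and these vanish.\<close>

lemma square_growth_bound:
  fixes u :: "real \<Rightarrow> real"
  assumes der: "\<And>t. 0 \<le> t \<Longrightarrow> (u has_real_derivative u' t) (at t)"
    and bound: "\<And>t. 0 \<le> t \<Longrightarrow> \<bar>u' t\<bar> \<le> L * \<bar>u t\<bar> + e"
    and "u 0 = 0" "0 \<le> e" "0 \<le> L" "0 \<le> t"
  shows "(u t)\<^sup>2 \<le> e\<^sup>2 * t * exp ((2 * L + 1) * t)"
proof -
  \<comment> \<open>Gronwall's argument is run for the square, since \<bar>u\<bar> need not be
    differentiable at its zeros. Splitting the mixed term \<open>2 * \<bar>u s\<bar> * e\<close>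
    into two squares causes the extra 1 in the rate \<open>2 * L + 1\<close>.\<close>
  define F where "F = (\<lambda>s. (u s)\<^sup>2 * exp (- ((2 * L + 1) * s)) - e\<^sup>2 * s)"
  have "F t \<le> F 0"
  proof (rule DERIV_nonpos_imp_nonincreasing[OF \<open>0 \<le> t\<close>], intro exI conjI)
    fix s assume s: "0 \<le> s" "s \<le> t"
    let ?x = "exp (- ((2 * L + 1) * s))"
    show "(F has_real_derivative
        (2 * u s * u' s - (2 * L + 1) * (u s)\<^sup>2) * ?x - e\<^sup>2) (at s)"
      unfolding F_def
      by (rule derivative_eq_intros der[OF s(1)] refl | simp add: algebra_simps)+
    have "2 * u s * u' s \<le> 2 * \<bar>u s\<bar> * \<bar>u' s\<bar>"
      by (metis abs_ge_self abs_mult abs_numeral mult.assoc)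
    also have "\<dots> \<le> 2 * \<bar>u s\<bar> * (L * \<bar>u s\<bar> + e)"
      using bound[OF s(1)] by (intro mult_left_mono) auto
    also have "\<dots> = 2 * L * (u s)\<^sup>2 + 2 * \<bar>u s\<bar> * e"
      by (simp add: algebra_simps power2_eq_square)
    also have "2 * \<bar>u s\<bar> * e \<le> (u s)\<^sup>2 + e\<^sup>2"
      using sum_squares_bound[of "\<bar>u s\<bar>" e] by simp
    finally have "2 * u s * u' s - (2 * L + 1) * (u s)\<^sup>2 \<le> e\<^sup>2"
      by (simp add: algebra_simps)
    then have "(2 * u s * u' s - (2 * L + 1) * (u s)\<^sup>2) * ?x \<le> e\<^sup>2 * ?x"
      by (intro mult_right_mono) auto
    also have "\<dots> \<le> e\<^sup>2 * 1"
      using s \<open>0 \<le> L\<close> by (intro mult_left_mono) auto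
    finally show "(2 * u s * u' s - (2 * L + 1) * (u s)\<^sup>2) * ?x - e\<^sup>2 \<le> 0"
      by simp
  qed
  then have "(u t)\<^sup>2 * exp (- ((2 * L + 1) * t)) \<le> e\<^sup>2 * t"
    by (simp add: F_def \<open>u 0 = 0\<close>)
  then have "(u t)\<^sup>2 * exp (- ((2 * L + 1) * t)) * exp ((2 * L + 1) * t)
      \<le> e\<^sup>2 * t * exp ((2 * L + 1) * t)"
    by (intro mult_right_mono) auto
  then show ?thesis
    by (simp add: mult.assoc exp_add[symmetric])
qed

lemma zero_if_derivative_dominated:
  fixes w :: "real \<Rightarrow> real"
  assumes der: "\<And>t. (w has_real_derivative w' t) (at t)"
    and bound: "\<And>t. \<bar>w' t\<bar> \<le> L * \<bar>w t\<bar>"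
    and "w t0 = 0" "0 \<le> L"
  shows "w t = 0"
proof (cases "t0 \<le> t")
  case True
  have "(w (t0 + (t - t0)))\<^sup>2 \<le> 0\<^sup>2 * (t - t0) * exp ((2 * L + 1) * (t - t0))"
  proof (rule square_growth_bound[where u' = "\<lambda>s. w' (t0 + s)"])
    show "((\<lambda>s. w (t0 + s)) has_real_derivative w' (t0 + s)) (at s)" for s
      using DERIV_shift[of w "w' (t0 + s)" s t0] der by (simp add: add.commute)
  qed (use assms True in auto)
  then show ?thesis by simp
next
  case False
  have "(w (t0 - (t0 - t)))\<^sup>2 \<le> 0\<^sup>2 * (t0 - t) * exp ((2 * L + 1) * (t0 - t))"
  proof (rule square_growth_bound[where u' = "\<lambda>s. - w' (t0 - s)"])
    show "((\<lambda>s. w (t0 - s)) has_real_derivative - w' (t0 - s)) (at s)" for s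
      by (rule DERIV_chain'[OF _ der, THEN DERIV_cong] derivative_eq_intros refl | simp)+
  qed (use assms False in auto)
  then show ?thesis by simp
qed

lemma abs_sin_diff_le: "\<bar>sin x - sin y\<bar> \<le> \<bar>x - y\<bar>" for x y :: real
proof -
  have "sin x - sin y = 2 * sin ((x - y) / 2) * cos ((x + y) / 2)"
    by (rule sin_diff_sin)
  then have "\<bar>sin x - sin y\<bar> = 2 * \<bar>sin ((x - y) / 2)\<bar> * \<bar>cos ((x + y) / 2)\<bar>"
    by (simp add: abs_mult)
  also have "\<dots> \<le> 2 * \<bar>(x - y) / 2\<bar> * 1"
    using abs_sin_x_le_abs_x[of "(x - y) / 2"] by (intro mult_mono) auto
  finally show ?thesis by simp
qed

lemma global_antiderivative:
  fixes f :: "real \<Rightarrow> real"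
  assumes "continuous_on UNIV f"
  shows "\<exists>F. F 0 = 0 \<and> (\<forall>t. (F has_real_derivative f t) (at t))"
proof -
  have "\<exists>F. \<forall>x. - \<infinity> < ereal x \<longrightarrow> ereal x < \<infinity> \<longrightarrow> (F has_vector_derivative f x) (at x)"
    using assms by (intro einterval_antiderivative) (auto simp: continuous_on_eq_continuous_at)
  then obtain F where F: "\<And>x. (F has_vector_derivative f x) (at x)" by auto
  show ?thesis
    by (rule exI[of _ "\<lambda>t. F t - F 0"])
      (auto intro!: derivative_eq_intros F simp: has_real_derivative_iff_has_vector_derivative)
qed

text \<open>Integrating the weight \<open>exp (a * \<bar>t\<bar>)\<close> gains a factor
  \<open>1 / a\<close>; this gain makes Picard iteration contract in a weighted sup norm. Negative
  times reduce to positive ones by reflection.\<close>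

lemma exp_growth_bound:
  fixes G :: "real \<Rightarrow> real"
  assumes der: "\<And>t. (G has_real_derivative G' t) (at t)" and "G 0 = 0"
    and bound: "\<And>t. \<bar>G' t\<bar> \<le> K * exp (a * \<bar>t\<bar>)" and "0 < a"
  shows "\<bar>G t\<bar> \<le> K / a * (exp (a * \<bar>t\<bar>) - 1)"
proof -
  have forward: "H t \<le> K / a * (exp (a * t) - 1)"
    if der: "\<And>t. ((H :: real \<Rightarrow> real) has_real_derivative H' t) (at t)" and "H 0 = 0"
      and bound: "\<And>t. \<bar>H' t\<bar> \<le> K * exp (a * \<bar>t\<bar>)" and "0 \<le> t" for H H' :: "real \<Rightarrow> real" and t
  proof -
    have "H t - K / a * exp (a * t) \<le> H 0 - K / a * exp (a * 0)"
    proof (rule DERIV_nonpos_imp_nonincreasing[OF \<open>0 \<le> t\<close>], intro exI conjI)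
      fix s :: real assume s: "0 \<le> s"
      show "((\<lambda>t. H t - K / a * exp (a * t)) has_real_derivative H' s - K * exp (a * s)) (at s)"
        using \<open>0 < a\<close> by (auto intro!: derivative_eq_intros der)
      show "H' s - K * exp (a * s) \<le> 0"
        using bound[of s] s by simp
    qed
    then show ?thesis using \<open>H 0 = 0\<close> by (simp add: algebra_simps)
  qed
  have reflect: "((\<lambda>s. H (- s)) has_real_derivative - H' (- s)) (at s)"
    if "\<And>t. (H has_real_derivative H' t) (at t)" for H H' :: "real \<Rightarrow> real" and s
    using DERIV_mirror that by blast
  have neg: "((\<lambda>s. - H s) has_real_derivative - H' s) (at s)"
    if "\<And>t. (H has_real_derivative H' t) (at t)" for H H' :: "real \<Rightarrow> real" and s
    using that by (intro DERIV_minus)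
  have "\<bar>H t\<bar> \<le> K / a * (exp (a * t) - 1)"
    if "\<And>t. (H has_real_derivative H' t) (at t)" and "H 0 = 0"
      and "\<And>t. \<bar>H' t\<bar> \<le> K * exp (a * \<bar>t\<bar>)" and "0 \<le> t" for H H' t
    using forward[of H H' t] forward[OF neg[of H H'], of t] that by (simp add: abs_le_iff)
  note fwd = this
  have "\<bar>- G' (- s)\<bar> \<le> K * exp (a * \<bar>s\<bar>)" for s
    using bound[of "- s"] by simp
  from fwd[OF der \<open>G 0 = 0\<close> bound, of t] fwd[OF reflect[OF der] _ this, of "- t"]
  show ?thesis
    using \<open>G 0 = 0\<close> by (cases "0 \<le> t") auto
qed

text \<open>Sine is globally Lipschitz, so an exponentially weighted sup norm turns the Picard map
  into a contraction on the whole line at once, and no local solutions have to be glued.\<close>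

lemma pendulum_solution_exists:
  fixes h :: "real \<Rightarrow> real"
  assumes h: "continuous_on UNIV h"
  shows "\<exists>\<phi>. \<phi> 0 = x \<and> (\<forall>t. (\<phi> has_real_derivative h t - a * sin (\<phi> t)) (at t))"
proof -
  \<comment> \<open>The Picard map has Lipschitz constant at most \<open>\<bar>a\<bar> / k\<close>,
    hence at most 1/2; the summand 1 keeps the rate positive for \<open>a = 0\<close>.\<close>
  define k where "k = 2 * \<bar>a\<bar> + 1"
  have k: "0 < k" by (simp add: k_def)
  obtain H where H: "H 0 = 0" "\<And>t. (H has_real_derivative h t) (at t)"
    using global_antiderivative[OF h] by blast
  \<comment> \<open>The unknown \<open>u\<close> is bounded: it remains of the solution after the
    initial value and the integrated forcing are subtracted and the weight is divided out.\<close>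
  define \<phi> where "\<phi> = (\<lambda>u t. x + H t + exp (k * \<bar>t\<bar>) * apply_bcontfun u t)"
  have "continuous_on UNIV H"
    by (rule DERIV_continuous_on) (use H(2) in simp)
  then have cont: "continuous_on UNIV (\<phi> u)" for u
    unfolding \<phi>_def by (intro continuous_intros continuous_on_apply_bcontfun)
  have "\<forall>u. \<exists>F. F 0 = 0 \<and> (\<forall>t. (F has_real_derivative - a * sin (\<phi> u t)) (at t))"
    by (intro allI global_antiderivative continuous_intros cont)
  then obtain F where F: "\<And>u. F u 0 = 0"
    "\<And>u t. (F u has_real_derivative - a * sin (\<phi> u t)) (at t)"
    by metis
  have bd: "\<bar>F u t\<bar> \<le> \<bar>a\<bar> / k * (exp (k * \<bar>t\<bar>) - 1)" for u t
  proof (rule exp_growth_bound[OF F(2) F(1) _ k])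
    show "\<bar>- a * sin (\<phi> u s)\<bar> \<le> \<bar>a\<bar> * exp (k * \<bar>s\<bar>)" for s
      using k by (auto simp: abs_mult intro!: mult_mono order_trans[OF abs_sin_le_one])
  qed
  define P where "P = (\<lambda>u t. exp (- k * \<bar>t\<bar>) * F u t)"
  have "P u \<in> bcontfun" for u
  proof (rule bcontfun_normI)
    have "continuous_on UNIV (F u)"
      by (rule DERIV_continuous_on) (use F(2) in simp)
    then show "continuous_on UNIV (P u)"
      unfolding P_def by (intro continuous_intros)
    show "norm (P u t) \<le> \<bar>a\<bar> / k" for t
    proof -
      have "norm (P u t) \<le> exp (- k * \<bar>t\<bar>) * (\<bar>a\<bar> / k * (exp (k * \<bar>t\<bar>) - 1))"
        unfolding P_def using mult_left_mono[OF bd[of u t], of "exp (- k * \<bar>t\<bar>)"]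
        by (simp add: abs_mult)
      also have "\<dots> = \<bar>a\<bar> / k * (1 - exp (- k * \<bar>t\<bar>))"
        by (simp add: algebra_simps exp_minus field_simps)
      also have "\<dots> \<le> \<bar>a\<bar> / k * 1"
        using k by (intro mult_left_mono) auto
      finally show ?thesis by simp
    qed
  qed
  then have app: "apply_bcontfun (Bcontfun (P u)) = P u" for u
    by (simp add: Bcontfun_inverse)
  have "dist (Bcontfun (P u)) (Bcontfun (P v)) \<le> 1 / 2 * dist u v" for u v
  proof (rule dist_bound)
    fix t
    have "\<bar>F u t - F v t\<bar> \<le> (\<bar>a\<bar> * dist u v) / k * (exp (k * \<bar>t\<bar>) - 1)"
    proof (rule exp_growth_bound[where G = "\<lambda>t. F u t - F v t", OF _ _ _ k])
      show "((\<lambda>t. F u t - F v t) has_real_derivative - a * sin (\<phi> u s) - (- a * sin (\<phi> v s))) (at s)" for s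
        by (intro DERIV_diff F)
      fix s
      have "\<bar>- a * sin (\<phi> u s) - (- a * sin (\<phi> v s))\<bar> = \<bar>a\<bar> * \<bar>sin (\<phi> u s) - sin (\<phi> v s)\<bar>"
        unfolding abs_mult[symmetric] abs_minus_commute[of "- a * sin (\<phi> u s)"]
        by (simp add: algebra_simps)
      also have "\<dots> \<le> \<bar>a\<bar> * \<bar>\<phi> u s - \<phi> v s\<bar>"
        by (intro mult_left_mono abs_sin_diff_le) auto
      also have "\<bar>\<phi> u s - \<phi> v s\<bar> = exp (k * \<bar>s\<bar>) * dist (apply_bcontfun u s) (apply_bcontfun v s)"
        by (simp add: \<phi>_def dist_real_def right_diff_distrib[symmetric] abs_mult)
      also have "\<bar>a\<bar> * \<dots> \<le> \<bar>a\<bar> * (exp (k * \<bar>s\<bar>) * dist u v)"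
        by (intro mult_left_mono dist_bounded) auto
      finally show "\<bar>- a * sin (\<phi> u s) - (- a * sin (\<phi> v s))\<bar> \<le> \<bar>a\<bar> * dist u v * exp (k * \<bar>s\<bar>)"
        by (simp add: mult.commute mult.left_commute)
    qed (simp add: F)
    then have "exp (- k * \<bar>t\<bar>) * \<bar>F u t - F v t\<bar>
        \<le> exp (- k * \<bar>t\<bar>) * ((\<bar>a\<bar> * dist u v) / k * (exp (k * \<bar>t\<bar>) - 1))"
      by (intro mult_left_mono) auto
    also have "\<dots> = (\<bar>a\<bar> * dist u v) / k * (1 - exp (- k * \<bar>t\<bar>))"
      by (simp add: algebra_simps exp_minus field_simps)
    also have "\<dots> \<le> (\<bar>a\<bar> * dist u v) / k * 1"
      using k by (intro mult_left_mono) auto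
    also have "\<dots> \<le> 1 / 2 * dist u v"
      using mult_right_mono[of "2 * \<bar>a\<bar>" k "dist u v"] k by (simp add: field_simps k_def)
    finally show "dist (apply_bcontfun (Bcontfun (P u)) t) (apply_bcontfun (Bcontfun (P v)) t)
        \<le> 1 / 2 * dist u v"
      unfolding app dist_real_def by (simp add: P_def right_diff_distrib[symmetric] abs_mult)
  qed
  then have "\<exists>!u. Bcontfun (P u) = u"
    by (intro banach_fix_type[where c = "1/2"]) auto
  then obtain u where "Bcontfun (P u) = u" by blast
  then have u: "apply_bcontfun u = P u" using app[of u] by simp
  have "\<phi> u = (\<lambda>t. x + H t + F u t)"
    unfolding \<phi>_def u P_def by (simp add: mult.assoc[symmetric] exp_add[symmetric])
  moreover have "((\<lambda>t. x + H t + F u t) has_real_derivative h t - a * sin (\<phi> u t)) (at t)" for t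
    by (auto intro!: derivative_eq_intros H F)
  ultimately have "((\<phi> u) has_real_derivative h t - a * sin (\<phi> u t)) (at t)" for t
    by metis
  moreover have "\<phi> u 0 = x"
    using \<open>\<phi> u = _\<close> H F by simp
  ultimately show ?thesis by blast
qed

text \<open>Unlike in \<open>is_sol\<close>, the three coefficients are independent: the Perron
  branch moves \<open>c\<close> and \<open>m\<close> with \<open>b\<close> fixed, and it lives at
  negative \<open>m\<close>.\<close>

definition josephson :: "real \<Rightarrow> real \<Rightarrow> real \<Rightarrow> (real \<Rightarrow> real) \<Rightarrow> bool" where
  "josephson c b m \<phi> \<longleftrightarrow>
     (\<forall>t. (\<phi> has_real_derivative b + 2 * m * cos t - 2 * c * sin (\<phi> t)) (at t))"

lemma is_sol_iff_josephson:
  "0 < \<omega> \<Longrightarrow> is_sol \<omega> B A \<phi> \<longleftrightarrow> josephson (1 / (2 * \<omega>)) (B / \<omega>) (A / (2 * \<omega>)) \<phi>"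
  unfolding is_sol_def josephson_def by (simp add: algebra_simps)

lemma josephson_derivative:
  "josephson c b m \<phi> \<Longrightarrow> (\<phi> has_real_derivative b + 2 * m * cos t - 2 * c * sin (\<phi> t)) (at t)"
  by (simp add: josephson_def)

lemma josephson_exists: "\<exists>\<phi>. josephson c b m \<phi> \<and> \<phi> 0 = x"
proof -
  have "continuous_on UNIV (\<lambda>t. b + 2 * m * cos t)"
    by (intro continuous_intros)
  from pendulum_solution_exists[OF this, of x "2 * c"] show ?thesis
    unfolding josephson_def by blast
qed

lemma josephson_continuous: "josephson c b m \<phi> \<Longrightarrow> continuous_on S \<phi>"
  by (rule DERIV_continuous_on, rule has_field_derivative_at_within, erule josephson_derivative)

lemma josephson_unique:
  assumes "josephson c b m \<phi>" "josephson c b m \<psi>" "\<phi> t0 = \<psi> t0"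
  shows "\<phi> t = \<psi> t"
proof -
  have "(\<lambda>t. \<phi> t - \<psi> t) t = 0"
  proof (rule zero_if_derivative_dominated[where w = "\<lambda>t. \<phi> t - \<psi> t" and L = "\<bar>2 * c\<bar>"])
    show "((\<lambda>t. \<phi> t - \<psi> t) has_real_derivative
        (b + 2 * m * cos s - 2 * c * sin (\<phi> s)) - (b + 2 * m * cos s - 2 * c * sin (\<psi> s))) (at s)" for s
      by (intro DERIV_diff josephson_derivative assms)
    fix s
    have "\<bar>(b + 2 * m * cos s - 2 * c * sin (\<phi> s)) - (b + 2 * m * cos s - 2 * c * sin (\<psi> s))\<bar>
        = \<bar>2 * c\<bar> * \<bar>sin (\<phi> s) - sin (\<psi> s)\<bar>"
      unfolding abs_mult[symmetric] abs_minus_commute[of "b + 2 * m * cos s - 2 * c * sin (\<phi> s)"]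
      by (simp add: algebra_simps)
    also have "\<dots> \<le> \<bar>2 * c\<bar> * \<bar>\<phi> s - \<psi> s\<bar>"
      by (intro mult_left_mono abs_sin_diff_le) auto
    finally show "\<bar>(b + 2 * m * cos s - 2 * c * sin (\<phi> s)) - (b + 2 * m * cos s - 2 * c * sin (\<psi> s))\<bar>
        \<le> \<bar>2 * c\<bar> * \<bar>\<phi> s - \<psi> s\<bar>" .
  qed (use assms in auto)
  then show ?thesis by simp
qed

section \<open>Symmetries, periodic solutions and dependence on parameters\<close>

lemma sin_plus_int_2pi: "sin (x + 2 * pi * of_int k) = sin x"
  by (simp add: sin_add sin_int_2pin cos_int_2pin)

lemma josephson_translate:
  assumes "josephson c b m \<phi>"
  shows "josephson c b m (\<lambda>t. \<phi> t + 2 * pi * of_int k)"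
  unfolding josephson_def sin_plus_int_2pi
  by (auto intro!: derivative_eq_intros josephson_derivative[OF assms])

lemma josephson_shift_2pi:
  assumes "josephson c b m \<phi>"
  shows "josephson c b m (\<lambda>t. \<phi> (t + 2 * pi))"
  unfolding josephson_def
proof
  fix t
  show "((\<lambda>t. \<phi> (t + 2 * pi)) has_real_derivative b + 2 * m * cos t - 2 * c * sin (\<phi> (t + 2 * pi))) (at t)"
    using josephson_derivative[OF assms, of "t + 2 * pi"] unfolding DERIV_shift by simp
qed

text \<open>Half a period reverses the sign of the cosine. This carries the periodic solution coming
  from the Heun polynomial, which belongs to the amplitude \<open>- \<mu>\<close>, to the positive
  amplitude \<open>\<mu>\<close>.\<close>

lemma josephson_shift_pi:
  assumes "josephson c b m \<phi>" "s = pi \<or> s = - pi"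
  shows "josephson c b (- m) (\<lambda>t. \<phi> (t + s))"
  unfolding josephson_def
proof
  fix t
  show "((\<lambda>t. \<phi> (t + s)) has_real_derivative b + 2 * - m * cos t - 2 * c * sin (\<phi> (t + s))) (at t)"
    using josephson_derivative[OF assms(1), of "t + s"] assms(2) unfolding DERIV_shift
    by (auto simp: cos_diff)
qed

lemma josephson_reflect:
  assumes "josephson c b m \<phi>"
  shows "josephson c b m (\<lambda>t. of_int (2 * k + 1) * pi - \<phi> (- t))"
  unfolding josephson_def
proof
  fix t
  have "sin (of_int (2 * k + 1) * pi - \<phi> (- t)) = sin (pi - \<phi> (- t) + 2 * pi * of_int k)"
    by (simp add: algebra_simps)
  then have "sin (of_int (2 * k + 1) * pi - \<phi> (- t)) = sin (\<phi> (- t))"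
    unfolding sin_plus_int_2pi by simp
  moreover have "((\<lambda>t. \<phi> (- t)) has_real_derivative - (b + 2 * m * cos (- t) - 2 * c * sin (\<phi> (- t)))) (at t)"
    using josephson_derivative[OF assms, of "- t"] DERIV_mirror by blast
  ultimately show "((\<lambda>t. of_int (2 * k + 1) * pi - \<phi> (- t)) has_real_derivative
      b + 2 * m * cos t - 2 * c * sin (of_int (2 * k + 1) * pi - \<phi> (- t))) (at t)"
    by (auto intro!: derivative_eq_intros)
qed

lemma josephson_periodic:
  assumes "josephson c b m \<phi>" "\<phi> (t0 + 2 * pi) = \<phi> t0 + 2 * pi * of_int k"
  shows "\<phi> (t + 2 * pi) = \<phi> t + 2 * pi * of_int k"
  using josephson_unique[OF josephson_shift_2pi josephson_translate, OF assms(1,1,2)] .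

lemma josephson_iterate:
  assumes "josephson c b m \<phi>" "\<phi> (2 * pi) = \<phi> 0 + 2 * pi * of_int k"
  shows "\<phi> (2 * pi * real n) = \<phi> 0 + 2 * pi * of_int k * real n"
proof (induction n)
  case (Suc n)
  have "\<phi> (2 * pi * real n + 2 * pi) = \<phi> (2 * pi * real n) + 2 * pi * of_int k"
    by (rule josephson_periodic[OF assms(1), of 0]) (simp add: assms(2))
  then show ?case using Suc by (simp add: algebra_simps)
qed simp

text \<open>If the order were reversed at some time, the two solutions would meet by the
  intermediate value theorem and then coincide everywhere.\<close>

lemma josephson_mono:
  assumes "josephson c b m \<phi>" "josephson c b m \<psi>" "\<phi> 0 \<le> \<psi> 0"
  shows "\<phi> t \<le> \<psi> t"
proof (rule ccontr)
  assume less: "\<not> \<phi> t \<le> \<psi> t"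
  have cont: "continuous_on S (\<lambda>t. \<psi> t - \<phi> t)" for S
    by (rule continuous_on_diff[OF josephson_continuous[OF assms(2)] josephson_continuous[OF assms(1)]])
  have 0: "0 \<le> \<psi> 0 - \<phi> 0" and t: "\<psi> t - \<phi> t \<le> 0" using assms(3) less by simp_all
  obtain s where "\<psi> s - \<phi> s = 0"
  proof (cases "t \<le> 0")
    case True
    from IVT'[where f = "\<lambda>t. \<psi> t - \<phi> t", OF t 0 True cont] that show thesis by blast
  next
    case False
    then have "0 \<le> t" by simp
    from IVT2'[where f = "\<lambda>t. \<psi> t - \<phi> t", OF t 0 this cont] that show thesis by blast
  qed
  then have "\<phi> s = \<psi> s" by simp
  then have "\<phi> t = \<psi> t" by (rule josephson_unique[OF assms(1,2)])
  then show False using less by simp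
qed

text \<open>For \<open>x \<equiv> \<pi>/2 (mod \<pi>)\<close> the solution through \<open>(0, x)\<close> is symmetric about this point, so that
  half a period determines the Poincare map at \<open>x\<close>.\<close>
lemma josephson_half_period:
  assumes \<phi>: "josephson c b m \<phi>" and x: "2 * \<phi> 0 = of_int (2 * j + 1) * pi"
    and half: "\<phi> pi = \<phi> 0 + pi * of_int k"
  shows "\<phi> (2 * pi) = \<phi> 0 + 2 * pi * of_int k"
proof -
  have "\<phi> t = of_int (2 * j + 1) * pi - \<phi> (- t)" for t
    by (rule josephson_unique[OF \<phi> josephson_reflect[OF \<phi>], of 0]) (use x in simp)
  from this[of pi] have "\<phi> (- pi) = \<phi> 0 - pi * of_int k"
    unfolding x[symmetric] half by simp
  then have "\<phi> (- pi + 2 * pi) = \<phi> (- pi) + 2 * pi * of_int k"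
    using half by simp
  from josephson_periodic[OF \<phi> this, of 0] show ?thesis by simp
qed

text \<open>The discrepancy of the coefficients acts as the inhomogeneity \<open>e\<close> in
  \<open>square_growth_bound\<close>. Only the \<open>c\<close> of the first solution enters the
  exponential, which suits continuity at a fixed parameter.\<close>

lemma josephson_dependence:
  assumes \<phi>: "josephson c b m \<phi>" and \<psi>: "josephson c' b m' \<psi>" and "\<phi> 0 = \<psi> 0" "0 \<le> T"
  shows "\<bar>\<phi> T - \<psi> T\<bar> \<le> (2 * \<bar>m - m'\<bar> + 2 * \<bar>c - c'\<bar>) * sqrt (T * exp ((4 * \<bar>c\<bar> + 1) * T))"
proof -
  define e where "e = 2 * \<bar>m - m'\<bar> + 2 * \<bar>c - c'\<bar>"
  have "((\<lambda>t. \<phi> t - \<psi> t) T)\<^sup>2 \<le> e\<^sup>2 * T * exp ((2 * (2 * \<bar>c\<bar>) + 1) * T)"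
  proof (rule square_growth_bound)
    show "((\<lambda>t. \<phi> t - \<psi> t) has_real_derivative
        (b + 2 * m * cos s - 2 * c * sin (\<phi> s)) - (b + 2 * m' * cos s - 2 * c' * sin (\<psi> s))) (at s)" for s
      by (intro DERIV_diff josephson_derivative assms)
    fix s
    have "(b + 2 * m * cos s - 2 * c * sin (\<phi> s)) - (b + 2 * m' * cos s - 2 * c' * sin (\<psi> s)) =
        2 * (m - m') * cos s - 2 * (c - c') * sin (\<psi> s) - 2 * c * (sin (\<phi> s) - sin (\<psi> s))"
      by (simp add: algebra_simps)
    also have "\<bar>\<dots>\<bar> \<le> \<bar>2 * (m - m') * cos s\<bar> + \<bar>2 * (c - c') * sin (\<psi> s)\<bar> + \<bar>2 * c * (sin (\<phi> s) - sin (\<psi> s))\<bar>"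
      by linarith
    also have "\<dots> \<le> 2 * \<bar>m - m'\<bar> * 1 + 2 * \<bar>c - c'\<bar> * 1 + 2 * \<bar>c\<bar> * \<bar>\<phi> s - \<psi> s\<bar>"
      unfolding abs_mult abs_numeral by (intro add_mono mult_left_mono abs_sin_diff_le) auto
    finally show "\<bar>(b + 2 * m * cos s - 2 * c * sin (\<phi> s)) - (b + 2 * m' * cos s - 2 * c' * sin (\<psi> s))\<bar>
        \<le> 2 * \<bar>c\<bar> * \<bar>\<phi> s - \<psi> s\<bar> + e"
      by (simp add: e_def)
  qed (use assms in \<open>auto simp: e_def\<close>)
  also have "\<dots> = (e * sqrt (T * exp ((4 * \<bar>c\<bar> + 1) * T)))\<^sup>2"
    using \<open>0 \<le> T\<close> by (simp add: power_mult_distrib)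
  finally have "\<bar>\<phi> T - \<psi> T\<bar>\<^sup>2 \<le> (e * sqrt (T * exp ((4 * \<bar>c\<bar> + 1) * T)))\<^sup>2"
    by simp
  then show ?thesis
    unfolding e_def by (rule power2_le_imp_le) (use \<open>0 \<le> T\<close> in auto)
qed

section \<open>The flow, the rotation number and the Poincare map\<close>

definition josephson_flow :: "real \<Rightarrow> real \<Rightarrow> real \<Rightarrow> real \<Rightarrow> real \<Rightarrow> real" where
  "josephson_flow c b m x = (SOME \<phi>. josephson c b m \<phi> \<and> \<phi> 0 = x)"

lemma josephson_flow:
  "josephson c b m (josephson_flow c b m x)" "josephson_flow c b m x 0 = x"
  using someI_ex[OF josephson_exists[of c b m x]] by (auto simp: josephson_flow_def)

lemma josephson_flow_continuous:
  assumes "continuous_on S c" "continuous_on S m" "0 \<le> T"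
  shows "continuous_on S (\<lambda>s. josephson_flow (c s) b (m s) x T)"
  unfolding continuous_on
proof
  fix s assume s: "s \<in> S"
  let ?f = "\<lambda>s. josephson_flow (c s) b (m s) x T"
  let ?R = "sqrt (T * exp ((4 * \<bar>c s\<bar> + 1) * T))"
  have c: "(c \<longlongrightarrow> c s) (at s within S)" and m: "(m \<longlongrightarrow> m s) (at s within S)"
    using assms s by (auto simp: continuous_on)
  have "((\<lambda>u. ?f u - ?f s) \<longlongrightarrow> 0) (at s within S)"
  proof (rule Lim_null_comparison)
    have "\<bar>?f s - ?f u\<bar> \<le> (2 * \<bar>m s - m u\<bar> + 2 * \<bar>c s - c u\<bar>) * ?R" for u
      using assms(3) by (intro josephson_dependence[OF josephson_flow(1) josephson_flow(1)])
        (auto simp: josephson_flow)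
    then show "\<forall>\<^sub>F u in at s within S.
        norm (?f u - ?f s) \<le> (2 * \<bar>m s - m u\<bar> + 2 * \<bar>c s - c u\<bar>) * ?R"
      by (simp add: abs_minus_commute)
    have "((\<lambda>u. (2 * \<bar>m s - m u\<bar> + 2 * \<bar>c s - c u\<bar>) * ?R) \<longlongrightarrow>
        (2 * \<bar>m s - m s\<bar> + 2 * \<bar>c s - c s\<bar>) * ?R) (at s within S)"
      by (intro tendsto_intros c m)
    then show "((\<lambda>u. (2 * \<bar>m s - m u\<bar> + 2 * \<bar>c s - c u\<bar>) * ?R) \<longlongrightarrow> 0) (at s within S)"
      by simp
  qed
  then show "(?f \<longlongrightarrow> ?f s) (at s within S)"
    by (simp add: LIM_zero_iff)
qed

text \<open>The 2 pi translates of one periodic solution cut the plane into strips that no solution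
  leaves. Inside its strip, \<open>\<psi>\<close> stays within bounded distance of linear growth
  with slope \<open>k\<close>.\<close>

lemma josephson_rotation_limit:
  assumes \<phi>: "josephson c b m \<phi>" and per: "\<phi> (2 * pi) = \<phi> 0 + 2 * pi * of_int k"
    and \<psi>: "josephson c b m \<psi>"
  shows "(\<lambda>n::nat. \<psi> (2 * pi * real n) / (2 * pi * real n)) \<longlonglongrightarrow> of_int k"
proof -
  define j where "j = \<lfloor>(\<psi> 0 - \<phi> 0) / (2 * pi)\<rfloor>"
  have "of_int j \<le> (\<psi> 0 - \<phi> 0) / (2 * pi)" "(\<psi> 0 - \<phi> 0) / (2 * pi) \<le> of_int (j + 1)"
    unfolding j_def by linarith+
  then have j: "\<phi> 0 + 2 * pi * of_int j \<le> \<psi> 0" "\<psi> 0 \<le> \<phi> 0 + 2 * pi * of_int (j + 1)"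
    by (simp_all add: pos_le_divide_eq pos_divide_le_eq algebra_simps)
  define C where "C = \<bar>\<phi> 0\<bar> + 2 * pi * (\<bar>of_int j\<bar> + 1)"
  have bound: "\<bar>\<psi> (2 * pi * real n) - 2 * pi * of_int k * real n\<bar> \<le> C" for n
  proof -
    have "\<phi> (2 * pi * real n) + 2 * pi * of_int j \<le> \<psi> (2 * pi * real n)"
      by (rule josephson_mono[OF josephson_translate[OF \<phi>] \<psi> j(1)])
    moreover have "\<psi> (2 * pi * real n) \<le> \<phi> (2 * pi * real n) + 2 * pi * of_int (j + 1)"
      by (rule josephson_mono[OF \<psi> josephson_translate[OF \<phi>] j(2)])
    moreover have "2 * pi * of_int j \<le> 2 * pi * \<bar>of_int j\<bar>" "- (2 * pi * \<bar>of_int j\<bar>) \<le> 2 * pi * of_int j"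
      using mult_left_mono[of "of_int j" "\<bar>of_int j\<bar>" "2 * pi"]
        mult_left_mono[of "- \<bar>of_int j\<bar>" "of_int j" "2 * pi"] by auto
    ultimately show ?thesis
      unfolding josephson_iterate[OF \<phi> per] C_def of_int_add distrib_left of_int_1 using pi_gt_zero
      by (intro abs_leI; linarith)
  qed
  have "(\<lambda>n. \<psi> (2 * pi * real n) / (2 * pi * real n) - of_int k) \<longlonglongrightarrow> 0"
  proof (rule Lim_null_comparison)
    show "\<forall>\<^sub>F n in sequentially.
        norm (\<psi> (2 * pi * real n) / (2 * pi * real n) - of_int k) \<le> C / (2 * pi) / real n"
      using eventually_gt_at_top[of 0]
    proof eventually_elim
      case (elim n)
      then have "\<psi> (2 * pi * real n) / (2 * pi * real n) - of_int k =
          (\<psi> (2 * pi * real n) - 2 * pi * of_int k * real n) / (2 * pi * real n)"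
        by (simp add: field_simps)
      then show ?case using bound[of n] elim by (simp add: divide_right_mono field_simps)
    qed
    show "(\<lambda>n. C / (2 * pi) / real n) \<longlonglongrightarrow> 0"
      by (rule lim_const_over_n)
  qed
  then show ?thesis by (simp add: LIM_zero_iff)
qed

lemma poincare_lift_eq:
  assumes "0 < \<omega>" "is_sol \<omega> B A \<phi>"
  shows "poincare_lift \<omega> B A (\<phi> 0) = \<phi> (2 * pi)"
  unfolding poincare_lift_def
proof (rule the_equality)
  show "\<exists>\<psi>. is_sol \<omega> B A \<psi> \<and> \<psi> 0 = \<phi> 0 \<and> \<psi> (2 * pi) = \<phi> (2 * pi)"
    using assms by blast
  fix y assume "\<exists>\<psi>. is_sol \<omega> B A \<psi> \<and> \<psi> 0 = \<phi> 0 \<and> \<psi> (2 * pi) = y"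
  then obtain \<psi> where "is_sol \<omega> B A \<psi>" "\<psi> 0 = \<phi> 0" "\<psi> (2 * pi) = y" by blast
  then show "y = \<phi> (2 * pi)"
    using josephson_unique[of _ _ _ \<psi> \<phi> 0 "2 * pi"] assms is_sol_iff_josephson by metis
qed

lemma periodic_solution_imp_phase_lock:
  assumes "0 < \<omega>" "josephson (1 / (2 * \<omega>)) (B / \<omega>) (A / (2 * \<omega>)) \<phi>"
    "\<phi> (2 * pi) = \<phi> 0 + 2 * pi * of_int k"
  shows "(B, A) \<in> phase_lock \<omega> k" "poincare_fixes \<omega> B A (\<phi> 0)"
proof -
  have sol: "is_sol \<omega> B A \<phi>" using assms by (simp add: is_sol_iff_josephson)
  have "rot_num \<omega> B A = of_int k"
    unfolding rot_num_def
  proof (rule the_equality)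
    show lim: "\<forall>\<psi>. is_sol \<omega> B A \<psi> \<longrightarrow>
        (\<lambda>n::nat. \<psi> (2 * pi * real n) / (2 * pi * real n)) \<longlonglongrightarrow> of_int k"
      using josephson_rotation_limit[OF assms(2,3)] assms(1) by (simp add: is_sol_iff_josephson)
    show "r = of_int k" if "\<forall>\<psi>. is_sol \<omega> B A \<psi> \<longrightarrow>
        (\<lambda>n::nat. \<psi> (2 * pi * real n) / (2 * pi * real n)) \<longlonglongrightarrow> r" for r
      using that lim sol LIMSEQ_unique by blast
  qed
  then show "(B, A) \<in> phase_lock \<omega> k" by (simp add: phase_lock_def)
  show "poincare_fixes \<omega> B A (\<phi> 0)"
    unfolding poincare_fixes_def poincare_lift_eq[OF assms(1) sol] using assms(3) by blast
qed

section \<open>Large amplitude\<close>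

lemma josephson_averaging:
  assumes \<phi>: "josephson c b m \<phi>" and "0 \<le> c" "0 \<le> m" "0 < M" "0 \<le> p" "p \<le> q" "q \<le> pi"
    and fast: "(\<forall>t\<in>{p..q}. M \<le> b + 2 * m * cos t) \<or> (\<forall>t\<in>{p..q}. b + 2 * m * cos t \<le> - M)"
  shows "\<phi> p - b * p - 2 * m * sin p - (8 * c + 4 * c\<^sup>2 * pi) / M \<le> \<phi> q - b * q - 2 * m * sin q"
proof -
  define g where "g = (\<lambda>t. b + 2 * m * cos t)"
  have g0: "g t \<noteq> 0" if "t \<in> {p..q}" for t
    using fast that \<open>0 < M\<close> by (fastforce simp: g_def)
  have inv: "\<bar>1 / g t\<bar> \<le> 1 / M" if "t \<in> {p..q}" for t
  proof -
    have "M \<le> \<bar>g t\<bar>" using fast that by (fastforce simp: g_def)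
    then show ?thesis using \<open>0 < M\<close> by (simp add: frac_le)
  qed
  text \<open>Integration by parts: \<open>\<phi>' \<approx> g\<close>, so the oscillating term \<open>-2c sin \<phi>\<close> is nearly the
    derivative of \<open>2c cos \<phi> / g\<close>; the last two terms dominate the error.\<close>
  define H where "H = (\<lambda>t. \<phi> t - b * t - 2 * m * sin t - 2 * c * cos (\<phi> t) / g t + 2 * c / g t + 4 * c\<^sup>2 / M * t)"
  have "H p \<le> H q"
  proof (rule DERIV_nonneg_imp_nondecreasing[OF \<open>p \<le> q\<close>], intro exI conjI)
    fix t assume t: "p \<le> t" "t \<le> q"
    then have gt: "g t \<noteq> 0" using g0 by simp
    \<comment> \<open>Differentiating \<open>1 / g\<close> leaves a term proportional to
      \<open>m\<close>. The summand \<open>2 * c / g t\<close> of \<open>H\<close> completes it to a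
      multiple of \<open>1 - cos (\<phi> t)\<close>, which is nonnegative because
      \<open>sin t\<close> is on [0, pi]. Only the term with the squared sine needs the drift
      \<open>4 * c\<^sup>2 / M\<close>.\<close>
    define D where "D = - 4 * c\<^sup>2 * (sin (\<phi> t))\<^sup>2 / g t + 2 * c * (1 - cos (\<phi> t)) * (2 * m * sin t) / (g t)\<^sup>2 + 4 * c\<^sup>2 / M"
    have dg: "(g has_real_derivative - 2 * m * sin t) (at t)"
      unfolding g_def by (auto intro!: derivative_eq_intros)
    have d\<phi>: "(\<phi> has_real_derivative g t - 2 * c * sin (\<phi> t)) (at t)"
      using josephson_derivative[OF \<phi>] by (simp add: g_def)
    have "(H has_real_derivative (g t - 2 * c * sin (\<phi> t)) - b - 2 * m * cos t
       - (2 * c * (- sin (\<phi> t) * (g t - 2 * c * sin (\<phi> t))) * g t - 2 * c * cos (\<phi> t) * (- 2 * m * sin t)) / (g t * g t)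
       + (0 * g t - 2 * c * (- 2 * m * sin t)) / (g t * g t) + 4 * c\<^sup>2 / M) (at t)"
      unfolding H_def using gt \<open>0 < M\<close>
      by (auto intro!: derivative_eq_intros d\<phi> dg)
    also have "(g t - 2 * c * sin (\<phi> t)) - b - 2 * m * cos t
       - (2 * c * (- sin (\<phi> t) * (g t - 2 * c * sin (\<phi> t))) * g t - 2 * c * cos (\<phi> t) * (- 2 * m * sin t)) / (g t * g t)
       + (0 * g t - 2 * c * (- 2 * m * sin t)) / (g t * g t) + 4 * c\<^sup>2 / M = D"
    proof -
      have e: "(g t - 2 * c * sin (\<phi> t)) - b - 2 * m * cos t = - 2 * c * sin (\<phi> t)"
        by (simp add: g_def)
      have gen: "- 2 * c * s - (2 * c * (- s * (G - 2 * c * s)) * G - 2 * c * x * (- 2 * m * u)) / (G * G)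
          + (0 * G - 2 * c * (- 2 * m * u)) / (G * G)
          = - 4 * c\<^sup>2 * s\<^sup>2 / G + 2 * c * (1 - x) * (2 * m * u) / G\<^sup>2"
        if "G \<noteq> 0" for G s x u :: real
        using that by (simp add: field_simps power2_eq_square)
      show ?thesis
        unfolding e D_def gen[OF gt] ..
    qed
    finally show "(H has_real_derivative D) (at t)" .
    have "(sin (\<phi> t))\<^sup>2 * (1 / g t) \<le> 1 * (1 / M)"
    proof (cases "0 \<le> 1 / g t")
      case True
      moreover have "(sin (\<phi> t))\<^sup>2 \<le> 1" by (simp add: abs_square_le_1)
      moreover have "1 / g t \<le> 1 / M" using inv[of t] t by (auto intro: abs_le_D1)
      ultimately show ?thesis by (intro mult_mono) auto
    next
      case False
      then have "(sin (\<phi> t))\<^sup>2 * (1 / g t) \<le> 0" by (intro mult_nonneg_nonpos) auto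
      also have "0 \<le> 1 * (1 / M)" using \<open>0 < M\<close> by simp
      finally show ?thesis .
    qed
    then have "4 * c\<^sup>2 * ((sin (\<phi> t))\<^sup>2 * (1 / g t)) \<le> 4 * c\<^sup>2 * (1 * (1 / M))"
      by (intro mult_left_mono) auto
    moreover have "0 \<le> sin t" using t assms by (intro sin_ge_zero) auto
    then have "0 \<le> 2 * c * (1 - cos (\<phi> t)) * (2 * m * sin t) / (g t)\<^sup>2"
      using assms by (intro divide_nonneg_nonneg mult_nonneg_nonneg) auto
    ultimately show "0 \<le> D" by (simp add: D_def)
  qed
  moreover have "\<bar>2 * c * cos (\<phi> t) / g t\<bar> \<le> 2 * c / M" "\<bar>2 * c / g t\<bar> \<le> 2 * c / M" if "t \<in> {p..q}" for t
  proof -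
    have "2 * c * \<bar>cos (\<phi> t)\<bar> * \<bar>1 / g t\<bar> \<le> 2 * c * 1 * (1 / M)"
      using inv[OF that] \<open>0 \<le> c\<close> by (intro mult_mono) auto
    then show "\<bar>2 * c * cos (\<phi> t) / g t\<bar> \<le> 2 * c / M" using \<open>0 \<le> c\<close> by (simp add: abs_mult)
    have "2 * c * \<bar>1 / g t\<bar> \<le> 2 * c * (1 / M)"
      using inv[OF that] \<open>0 \<le> c\<close> by (intro mult_left_mono) auto
    then show "\<bar>2 * c / g t\<bar> \<le> 2 * c / M" using \<open>0 \<le> c\<close> by (simp add: abs_mult)
  qed
  from this[of p] this[of q] have "\<bar>2 * c * cos (\<phi> p) / g p\<bar> \<le> 2 * c / M" "\<bar>2 * c / g p\<bar> \<le> 2 * c / M"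
    "\<bar>2 * c * cos (\<phi> q) / g q\<bar> \<le> 2 * c / M" "\<bar>2 * c / g q\<bar> \<le> 2 * c / M"
    using \<open>p \<le> q\<close> by auto
  \<comment> \<open>The error constant consists of four boundary terms of size at most
    \<open>2 * c / M\<close> and of the drift over a length of at most pi.\<close>
  moreover have "4 * c\<^sup>2 / M * q - 4 * c\<^sup>2 / M * p \<le> 4 * c\<^sup>2 * pi / M"
  proof -
    have "4 * c\<^sup>2 / M * (q - p) \<le> 4 * c\<^sup>2 / M * pi"
      using assms by (intro mult_left_mono) auto
    then show ?thesis by (simp only: right_diff_distrib times_divide_eq_left)
  qed
  moreover have "(8 * c + 4 * c\<^sup>2 * pi) / M = 4 * (2 * c / M) + 4 * c\<^sup>2 * pi / M"
    by (simp add: add_divide_distrib)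
  ultimately show ?thesis unfolding H_def by linarith
qed

text \<open>Averaging fails near pi/2, where the cosine vanishes. The total loss of pi is budgeted
  as pi/4 on each outer interval, by the choice of \<open>M\<close>, and at most
  \<open>4 * c * \<delta>\<close>, hence pi/2, on the middle one, where only the trivial bound on
  sine is used. Finally \<open>m\<close> makes the forcing exceed \<open>M\<close> in modulus
  outside the middle.\<close>

lemma josephson_large_amplitude:
  assumes "0 < c"
  shows "\<exists>m\<ge>0. \<forall>\<phi>. josephson c b m \<phi> \<longrightarrow> \<phi> 0 + (b - 1) * pi \<le> \<phi> pi"
proof -
  define \<delta> where "\<delta> = pi / (8 * c + 8)"
  define M where "M = 4 * (8 * c + 4 * c\<^sup>2 * pi) / pi"
  define m where "m = (M + \<bar>b\<bar>) / (2 * sin \<delta>)"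
  have "8 * c * pi \<le> (8 * c + 8) * pi" "8 * pi \<le> (8 * c + 8) * pi" using assms by auto
  then have \<delta>: "0 < \<delta>" "\<delta> \<le> pi / 8" "8 * c * \<delta> \<le> pi"
    using assms by (simp_all add: \<delta>_def field_simps)
  have M: "0 < M" using assms by (simp add: M_def add_pos_nonneg)
  have sin: "0 < sin \<delta>" using \<delta> by (intro sin_gt_zero) auto
  have m: "0 \<le> m" "2 * m * sin \<delta> = M + \<bar>b\<bar>" using M sin by (auto simp: m_def)
  have "\<phi> 0 + (b - 1) * pi \<le> \<phi> pi" if \<phi>: "josephson c b m \<phi>" for \<phi>
  proof -
    define G where "G = (\<lambda>t. \<phi> t - b * t - 2 * m * sin t)"
    have 1: "G 0 - (8 * c + 4 * c\<^sup>2 * pi) / M \<le> G (pi / 2 - \<delta>)"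
      unfolding G_def
    proof (rule josephson_averaging[OF \<phi>])
      have "M \<le> b + 2 * m * cos t" if "t \<in> {0..pi / 2 - \<delta>}" for t
      proof -
        have "cos (pi / 2 - \<delta>) \<le> cos t" using that \<delta> by (intro cos_monotone_0_pi_le) auto
        then have "2 * m * sin \<delta> \<le> 2 * m * cos t"
          using m(1) by (intro mult_left_mono) (auto simp: cos_diff)
        then show ?thesis using m by linarith
      qed
      then show "(\<forall>t\<in>{0..pi / 2 - \<delta>}. M \<le> b + 2 * m * cos t) \<or> (\<forall>t\<in>{0..pi / 2 - \<delta>}. b + 2 * m * cos t \<le> - M)"
        by blast
    qed (use assms m M \<delta> in auto)
    have 2: "G (pi / 2 + \<delta>) - (8 * c + 4 * c\<^sup>2 * pi) / M \<le> G pi"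
      unfolding G_def
    proof (rule josephson_averaging[OF \<phi>])
      have "b + 2 * m * cos t \<le> - M" if "t \<in> {pi / 2 + \<delta>..pi}" for t
      proof -
        have "cos t \<le> cos (pi / 2 + \<delta>)" using that \<delta> by (intro cos_monotone_0_pi_le) auto
        then have "2 * m * cos t \<le> 2 * m * - sin \<delta>"
          using m(1) by (intro mult_left_mono) (auto simp: cos_add)
        then show ?thesis using m by linarith
      qed
      then show "(\<forall>t\<in>{pi / 2 + \<delta>..pi}. M \<le> b + 2 * m * cos t) \<or> (\<forall>t\<in>{pi / 2 + \<delta>..pi}. b + 2 * m * cos t \<le> - M)"
        by blast
    qed (use assms m M \<delta> in auto)
    have 3: "G (pi / 2 - \<delta>) + 2 * c * (pi / 2 - \<delta>) \<le> G (pi / 2 + \<delta>) + 2 * c * (pi / 2 + \<delta>)"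
    proof (rule DERIV_nonneg_imp_nondecreasing, use \<delta> in simp, intro exI conjI)
      fix t
      show "((\<lambda>t. G t + 2 * c * t) has_real_derivative (- 2 * c * sin (\<phi> t)) + 2 * c) (at t)"
        unfolding G_def by (auto intro!: derivative_eq_intros josephson_derivative[OF \<phi>])
      have "2 * c * sin (\<phi> t) \<le> 2 * c * 1" using assms by (intro mult_left_mono) auto
      then show "0 \<le> - 2 * c * sin (\<phi> t) + 2 * c" by simp
    qed
    have 4: "(8 * c + 4 * c\<^sup>2 * pi) / M = pi / 4"
    proof -
      have "0 < 8 * c + 4 * c\<^sup>2 * pi" using assms by (simp add: add_pos_nonneg)
      then show ?thesis unfolding M_def by (simp add: divide_simps)
    qed
    have "G (pi / 2 - \<delta>) - 4 * c * \<delta> \<le> G (pi / 2 + \<delta>)"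
      using 3 by (simp add: algebra_simps)
    then have "G 0 - pi \<le> G pi" using 1 2 \<delta>(3) unfolding 4 by linarith
    then show ?thesis by (simp add: G_def algebra_simps)
  qed
  then show ?thesis using m by blast
qed

section \<open>Perron vectors and the Heun recursion\<close>

text \<open>Coefficients of a polynomial solution \<open>\<Sum>\<^sub>k \<epsilon>\<^sub>k (- z)\<^sup>k\<close>, of degree \<open>l - 1\<close>, of the double
  confluent Heun equation. They form the Perron eigenvector, with eigenvalue \<open>\<mu>\<close>, of the
  nonnegative matrix \<open>\<epsilon> \<mapsto> ((k + 1) \<epsilon>\<^sub>k\<^sub>+\<^sub>1 + c \<epsilon>\<^sub>l\<^sub>-\<^sub>1\<^sub>-\<^sub>k)\<^sub>k\<close>.\<close>
definition heun_vector :: "nat \<Rightarrow> real \<Rightarrow> real \<Rightarrow> (int \<Rightarrow> real) \<Rightarrow> bool" where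
  "heun_vector l c \<mu> \<epsilon> \<longleftrightarrow>
     (\<forall>k. \<epsilon> k > 0 \<longleftrightarrow> 0 \<le> k \<and> k < int l) \<and> (\<forall>k. \<epsilon> k \<ge> 0) \<and>
     (\<forall>k. \<mu> * \<epsilon> (k - 1) = of_int k * \<epsilon> k + c * \<epsilon> (int l - k))"

lemma heun_vector_zero: "heun_vector l c \<mu> \<epsilon> \<Longrightarrow> k < 0 \<or> int l \<le> k \<Longrightarrow> \<epsilon> k = 0"
  unfolding heun_vector_def by (metis less_eq_real_def linorder_not_less)

text \<open>Eliminating the reflected coefficient from the relation in \<open>heun_vector\<close>
  gives this recursion; its second clause is the general step with the value 0 at index -1. The
  eigenvalue condition becomes vanishing at index \<open>l\<close>.\<close>

fun heun_rec :: "nat \<Rightarrow> real \<Rightarrow> real \<Rightarrow> nat \<Rightarrow> real" where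
  "heun_rec l c \<mu> 0 = 1"
| "heun_rec l c \<mu> (Suc 0) = (\<mu>\<^sup>2 - c\<^sup>2) / \<mu>"
| "heun_rec l c \<mu> (Suc (Suc k)) =
     ((real (Suc k) * (real l - real (Suc k)) + \<mu>\<^sup>2 - c\<^sup>2) * heun_rec l c \<mu> (Suc k)
       - \<mu> * (real l - real (Suc k)) * heun_rec l c \<mu> k) / (\<mu> * real (Suc (Suc k)))"


lemma heun_rec_continuous:
  assumes "0 < c"
  shows "continuous_on {c..} (\<lambda>\<mu>. heun_rec l c \<mu> k)"
proof (induction k rule: less_induct)
  case (less k)
  consider "k = 0" | "k = Suc 0" | j where "k = Suc (Suc j)"
    by (metis not0_implies_Suc)
  then show ?case
  proof cases
    case (3 j)
    then have "continuous_on {c..} (\<lambda>\<mu>. heun_rec l c \<mu> j)"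
      "continuous_on {c..} (\<lambda>\<mu>. heun_rec l c \<mu> (Suc j))"
      using less by auto
    then show ?thesis
      unfolding 3 heun_rec.simps using assms by (intro continuous_intros) auto
  qed (use assms in \<open>auto intro!: continuous_intros\<close>)
qed

lemma heun_rec_step:
  assumes "0 < \<mu>" "0 < k"
  shows "\<mu> * real (Suc k) * heun_rec l c \<mu> (Suc k) =
    (real k * (real l - real k) + \<mu>\<^sup>2 - c\<^sup>2) * heun_rec l c \<mu> k
      - \<mu> * (real l - real k) * heun_rec l c \<mu> (k - 1)"
proof -
  obtain j where "k = Suc j" using assms(2) gr0_implies_Suc by blast
  then show ?thesis using assms(1) by (simp del: of_nat_Suc)
qed

text \<open>With this \<open>\<mu>\<close>, \<open>\<mu>\<^sup>2 - c\<^sup>2\<close> is at least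
  \<open>3 * l * \<mu>\<close>. The subtracted term costs at most \<open>l * \<mu>\<close> times the
  current value, and the remaining \<open>2 * l\<close> still dominates the divisor
  \<open>k + 1\<close>.\<close>

lemma heun_rec_large:
  assumes "0 < c" "k \<le> l"
  shows "0 < heun_rec l c (c + 3 * real l) k \<and>
    (0 < k \<longrightarrow> heun_rec l c (c + 3 * real l) (k - 1) \<le> heun_rec l c (c + 3 * real l) k)"
  using assms(2)
proof (induction k)
  case 0
  then show ?case by simp
next
  case (Suc k)
  define \<mu> where "\<mu> = c + 3 * real l"
  have l: "1 \<le> real l" using Suc.prems by simp
  have \<mu>: "0 < \<mu>" "3 * real l \<le> \<mu>" using assms l by (auto simp: \<mu>_def)
  have "\<mu>\<^sup>2 - c\<^sup>2 = (c + \<mu>) * (3 * real l)"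
    by (simp add: \<mu>_def power2_eq_square algebra_simps)
  also have "\<dots> \<ge> \<mu> * (3 * real l)"
    using assms l by (intro mult_right_mono) auto
  finally have big: "\<mu> * (3 * real l) \<le> \<mu>\<^sup>2 - c\<^sup>2" .
  have kl: "real k \<le> real l" using Suc.prems by simp
  have IH: "0 < heun_rec l c \<mu> k" "0 < k \<longrightarrow> heun_rec l c \<mu> (k - 1) \<le> heun_rec l c \<mu> k"
    using Suc by (auto simp: \<mu>_def)
  have "heun_rec l c \<mu> k \<le> heun_rec l c \<mu> (Suc k)"
  proof (cases "k = 0")
    case True
    have "\<mu> * 1 \<le> \<mu> * (3 * real l)" using l \<mu> by (intro mult_left_mono) auto
    then have "\<mu> \<le> \<mu>\<^sup>2 - c\<^sup>2" using big by linarith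
    then show ?thesis using True \<mu> by (simp add: pos_le_divide_eq)
  next
    case False
    have "\<mu> * (real l - real k) * heun_rec l c \<mu> (k - 1) \<le> \<mu> * real l * heun_rec l c \<mu> k"
    proof (cases "0 \<le> heun_rec l c \<mu> (k - 1)")
      case True
      then show ?thesis using IH False \<mu> kl by (intro mult_mono) auto
    next
      case False
      then have "\<mu> * (real l - real k) * heun_rec l c \<mu> (k - 1) \<le> 0"
        using \<mu> kl by (intro mult_nonneg_nonpos) auto
      also have "0 \<le> \<mu> * real l * heun_rec l c \<mu> k"
        using \<mu> IH by auto
      finally show ?thesis .
    qed
    moreover have "\<mu> * (3 * real l) * heun_rec l c \<mu> k
        \<le> (real k * (real l - real k) + \<mu>\<^sup>2 - c\<^sup>2) * heun_rec l c \<mu> k"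
    proof (rule mult_right_mono)
      have "0 \<le> real k * (real l - real k)" using kl by simp
      then show "\<mu> * (3 * real l) \<le> real k * (real l - real k) + \<mu>\<^sup>2 - c\<^sup>2"
        using big by linarith
    qed (use IH in simp)
    ultimately have "\<mu> * (2 * real l) * heun_rec l c \<mu> k \<le> \<mu> * real (Suc k) * heun_rec l c \<mu> (Suc k)"
      unfolding heun_rec_step[OF \<mu>(1) False[THEN neq0_conv[THEN iffD1]]]
      by (simp add: algebra_simps)
    then have "2 * real l * heun_rec l c \<mu> k \<le> real (Suc k) * heun_rec l c \<mu> (Suc k)"
      using \<mu> by (simp add: mult.assoc)
    moreover have "real (Suc k) * heun_rec l c \<mu> k \<le> 2 * real l * heun_rec l c \<mu> k"
      using IH Suc.prems l by (intro mult_right_mono) auto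
    ultimately have "real (Suc k) * heun_rec l c \<mu> k \<le> real (Suc k) * heun_rec l c \<mu> (Suc k)"
      by linarith
    then show ?thesis by (rule mult_left_le_imp_le) simp
  qed
  then show ?case using IH by (auto simp: \<mu>_def)
qed

text \<open>The intermediate value theorem is applied to the minimum of the terms 1 to l, since term
  1 vanishes at \<open>\<mu> = c\<close>. At a zero of the minimum all these terms are nonnegative,
  and a term vanishing before index \<open>l\<close> would make its successor negative. So the zero
  sits exactly at \<open>l\<close>: this replaces the Perron theorem.\<close>

lemma heun_rec_positive_solution:
  assumes "0 < c" "0 < l"
  shows "\<exists>\<mu>\<ge>c. heun_rec l c \<mu> l = 0 \<and> (\<forall>k<l. 0 < heun_rec l c \<mu> k)"
proof -
  define E where "E = heun_rec l c"
  define m where "m = (\<lambda>\<mu>. Min (E \<mu> ` {1..l}))"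
  have ne: "{1..l} \<noteq> {}" using assms by auto
  have m_le: "m \<mu> \<le> E \<mu> k" if "k \<in> {1..l}" for \<mu> k
    using that by (auto simp: m_def)
  have m_in: "\<exists>k\<in>{1..l}. m \<mu> = E \<mu> k" for \<mu>
  proof -
    have "m \<mu> \<in> E \<mu> ` {1..l}"
      unfolding m_def by (rule Min_in) (use ne in auto)
    then show ?thesis by blast
  qed
  have "continuous_on {c..} (\<lambda>\<mu>. Min ((\<lambda>k. E \<mu> k) ` K))" if "finite K" "K \<noteq> {}" for K
    using that
  proof (induction K rule: finite_ne_induct)
    case (singleton k)
    then show ?case using heun_rec_continuous[OF assms(1)] by (simp add: E_def)
  next
    case (insert k K)
    then show ?case
      using heun_rec_continuous[OF assms(1)] by (auto simp: E_def intro!: continuous_on_min)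
  qed
  from this[OF _ ne] have "continuous_on {c..} m"
    by (simp add: m_def)
  then have "continuous_on {c..c + 3 * real l} m"
    by (rule continuous_on_subset) auto
  moreover have "m c \<le> 0"
    using m_le[of 1 c] assms by (simp add: E_def)
  moreover have "0 \<le> m (c + 3 * real l)"
  proof -
    obtain k where k: "k \<in> {1..l}" "m (c + 3 * real l) = E (c + 3 * real l) k"
      using m_in by blast
    then show ?thesis
      using heun_rec_large[OF assms(1), of k l] by (simp add: E_def)
  qed
  ultimately obtain \<mu> where \<mu>: "c \<le> \<mu>" "m \<mu> = 0"
    using IVT'[of m c 0 "c + 3 * real l"] by auto
  have \<mu>0: "0 < \<mu>" using \<mu> assms by simp
  have step: "\<mu> * real (Suc k) * E \<mu> (Suc k) =
      (real k * (real l - real k) + \<mu>\<^sup>2 - c\<^sup>2) * E \<mu> k - \<mu> * (real l - real k) * E \<mu> (k - 1)"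
    if "0 < k" for k
    unfolding E_def by (rule heun_rec_step[OF \<mu>0 that])
  have E0: "E \<mu> 0 = 1" by (simp add: E_def)
  have nonneg: "0 \<le> E \<mu> k" if "k \<le> l" for k
    using m_le[of k \<mu>] \<mu> that by (cases "k = 0") (auto simp: E0)
  have pos: "0 < E \<mu> k" if "k < l" for k
    using that
  proof (induction k)
    case (Suc k)
    show ?case
    proof (rule ccontr)
      assume "\<not> 0 < E \<mu> (Suc k)"
      then have z: "E \<mu> (Suc k) = 0" using nonneg[of "Suc k"] Suc.prems by simp
      have "\<mu> * real (Suc (Suc k)) * E \<mu> (Suc (Suc k)) = - (\<mu> * (real l - real (Suc k)) * E \<mu> k)"
        using step[of "Suc k"] z by simp
      also have "\<dots> < 0" using Suc \<mu>0 by simp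
      finally have "E \<mu> (Suc (Suc k)) < 0"
        using \<mu>0 by (simp add: mult_less_0_iff)
      then show False using nonneg[of "Suc (Suc k)"] Suc.prems by simp
    qed
  qed (simp add: E0)
  obtain k where "k \<in> {1..l}" "E \<mu> k = 0"
    using m_in[of \<mu>] \<mu> by auto
  then have "E \<mu> l = 0" using pos[of k] by (cases "k = l") auto
  then show ?thesis using \<mu> pos by (auto simp: E_def)
qed

text \<open>The three-term recursion is \<open>T\<^sup>2 = c\<^sup>2\<close> for the operator \<open>(T \<epsilon>)\<^sub>l\<^sub>-\<^sub>k = \<mu> \<epsilon>\<^sub>k\<^sub>-\<^sub>1 - k \<epsilon>\<^sub>k\<close>.\<close>
lemma first_order_imp_three_term:
  fixes y :: "int \<Rightarrow> real"
  assumes "\<And>k. \<mu> * y (k - 1) = of_int k * y k + \<kappa> * y (l - k)" "\<kappa>\<^sup>2 = c\<^sup>2"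
  shows "\<mu> * of_int (k + 1) * y (k + 1) =
    (of_int k * of_int (l - k) + \<mu>\<^sup>2 - c\<^sup>2) * y k - \<mu> * of_int (l - k) * y (k - 1)"
proof -
  have 1: "\<mu> * y (l - k - 1) = of_int (l - k) * y (l - k) + \<kappa> * y k"
    using assms(1)[of "l - k"] by simp
  have 2: "\<mu> * y k = of_int (k + 1) * y (k + 1) + \<kappa> * y (l - k - 1)"
    using assms(1)[of "k + 1"] by (simp add: algebra_simps)
  have 3: "\<mu> * y (k - 1) = of_int k * y k + \<kappa> * y (l - k)"
    using assms(1)[of k] .
  have "\<mu> * (\<mu> * y k) = \<mu> * of_int (k + 1) * y (k + 1) + \<kappa> * (\<mu> * y (l - k - 1))"
    unfolding 2 by (simp add: algebra_simps)
  also have "\<kappa> * (\<mu> * y (l - k - 1)) = of_int (l - k) * (\<kappa> * y (l - k)) + \<kappa>\<^sup>2 * y k"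
    unfolding 1 by (simp add: algebra_simps power2_eq_square)
  also have "\<kappa> * y (l - k) = \<mu> * y (k - 1) - of_int k * y k"
    using 3 by simp
  finally show ?thesis
    using assms(2) by (simp add: algebra_simps power2_eq_square)
qed

text \<open>The leading coefficient is nonzero for nonnegative \<open>k\<close>, so a solution that
  vanishes at -1 is determined by its value at 0.\<close>

lemma three_term_proportional:
  fixes x y :: "int \<Rightarrow> real"
  assumes x: "\<And>k. 0 \<le> k \<Longrightarrow> k + 1 < l \<Longrightarrow> \<mu> * of_int (k + 1) * x (k + 1) = a k * x k - b k * x (k - 1)"
    and y: "\<And>k. 0 \<le> k \<Longrightarrow> k + 1 < l \<Longrightarrow> \<mu> * of_int (k + 1) * y (k + 1) = a k * y k - b k * y (k - 1)"
    and "x (-1) = 0" "y (-1) = 0" "x 0 \<noteq> 0" "\<mu> \<noteq> 0" "- 1 \<le> k" "k < l"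
  shows "y k = y 0 / x 0 * x k"
proof -
  define t where "t = y 0 / x 0"
  have "y k = t * x k \<and> (k + 1 < l \<longrightarrow> y (k + 1) = t * x (k + 1))"
    using \<open>- 1 \<le> k\<close> \<open>k < l\<close>
  proof (induction k rule: int_ge_induct)
    case base
    then show ?case using assms by (simp add: t_def)
  next
    case (step k)
    have k: "0 \<le> k + 1" using step by simp
    have IH: "y k = t * x k" "y (k + 1) = t * x (k + 1)" using step by auto
    have "y (k + 1 + 1) = t * x (k + 1 + 1)" if "k + 1 + 1 < l"
    proof -
      have "\<mu> * of_int (k + 1 + 1) * y (k + 1 + 1) = \<mu> * of_int (k + 1 + 1) * (t * x (k + 1 + 1))"
      proof -
        have "\<mu> * of_int (k + 1 + 1) * y (k + 1 + 1) = a (k + 1) * (t * x (k + 1)) - b (k + 1) * (t * x k)"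
          using y[OF k that] IH by simp
        also have "\<dots> = t * (a (k + 1) * x (k + 1) - b (k + 1) * x (k + 1 - 1))"
          by (simp add: right_diff_distrib mult.left_commute)
        also have "\<dots> = t * (\<mu> * of_int (k + 1 + 1) * x (k + 1 + 1))"
          using x[OF k that] by simp
        finally show ?thesis by (simp only: mult.left_commute)
      qed
      moreover have "\<mu> * of_int (k + 1 + 1) \<noteq> 0"
        using k \<open>\<mu> \<noteq> 0\<close> by (simp del: of_int_add)
      ultimately show ?thesis by (metis mult_left_cancel)
    qed
    then show ?case using IH by simp
  qed
  then show ?thesis by (simp add: t_def)
qed

text \<open>The recursion only says that the square of \<open>T\<close> acts as
  \<open>c\<^sup>2\<close>. But \<open>T \<epsilon>\<close> solves the same recursion and vanishes
  at -1, hence equals \<open>t * \<epsilon>\<close> with \<open>t\<close> equal to \<open>c\<close>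
  or \<open>- c\<close>; positivity of \<open>t = \<mu> * \<epsilon> (int l - 1)\<close> selects
  \<open>c\<close>.\<close>

lemma heun_vector_exists:
  assumes "0 < c" "0 < l"
  shows "\<exists>\<mu> \<epsilon>. c \<le> \<mu> \<and> heun_vector l c \<mu> \<epsilon>"
proof -
  obtain \<mu> where \<mu>: "c \<le> \<mu>" and zero: "heun_rec l c \<mu> l = 0"
    and pos: "\<And>k. k < l \<Longrightarrow> 0 < heun_rec l c \<mu> k"
    using heun_rec_positive_solution[OF assms] by blast
  have \<mu>0: "0 < \<mu>" using \<mu> assms by simp
  define \<epsilon> where "\<epsilon> = (\<lambda>k::int. if 0 \<le> k \<and> k < int l then heun_rec l c \<mu> (nat k) else 0)"
  \<comment> \<open>The cut-off by zero respects the recursion: at \<open>k = l - 1\<close> because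
    \<open>heun_rec\<close> vanishes at index \<open>l\<close>, and at \<open>k = l\<close> because
    the factor \<open>l - k\<close> does.\<close>
  have rec: "\<mu> * of_int (k + 1) * \<epsilon> (k + 1) =
      (of_int k * of_int (int l - k) + \<mu>\<^sup>2 - c\<^sup>2) * \<epsilon> k - \<mu> * of_int (int l - k) * \<epsilon> (k - 1)" for k
  proof -
    consider "k < -1" | "k = -1" | "k = 0" | "0 < k" "k < int l" | "k = int l" | "int l < k" by linarith
    then show ?thesis
    proof cases
      case 3
      then show ?thesis using \<mu>0 assms zero
        by (cases "l = 1") (auto simp: \<epsilon>_def power2_eq_square)
    next
      case 4
      define n where "n = nat k"
      have n: "k = int n" "0 < n" "n < l" using 4 by (auto simp: n_def)
      have "heun_rec l c \<mu> (Suc n) = 0" if "\<not> Suc n < l"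
        using that n zero Suc_lessI[of n l] by blast
      then have \<epsilon>: "\<epsilon> (k + 1) = heun_rec l c \<mu> (Suc n)" "\<epsilon> k = heun_rec l c \<mu> n"
        "\<epsilon> (k - 1) = heun_rec l c \<mu> (n - 1)"
        using n by (auto simp: \<epsilon>_def nat_add_distrib nat_diff_distrib)
      show ?thesis using heun_rec_step[OF \<mu>0 n(2), of l c] unfolding \<epsilon>
        by (simp add: n algebra_simps)
    qed (auto simp: \<epsilon>_def)
  qed
  define T where "T = (\<lambda>y::int \<Rightarrow> real. \<lambda>j. \<mu> * y (int l - j - 1) - of_int (int l - j) * y (int l - j))"
  have T: "T y j = \<mu> * y (int l - j - 1) - of_int (int l - j) * y (int l - j)" for y j
    by (simp add: T_def)
  have T_scale: "T (\<lambda>k. s * y k) j = s * T y j" for s y j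
    by (simp add: T algebra_simps)
  have TT: "T (T \<epsilon>) = (\<lambda>j. c\<^sup>2 * \<epsilon> j)"
    using rec by (auto simp: T algebra_simps power2_eq_square)
  have rec': "\<mu> * of_int (k + 1) * T \<epsilon> (k + 1) =
      (of_int k * of_int (int l - k) + \<mu>\<^sup>2 - c\<^sup>2) * T \<epsilon> k - \<mu> * of_int (int l - k) * T \<epsilon> (k - 1)" for k
  proof -
    have "T (T (T \<epsilon>)) k = c\<^sup>2 * T \<epsilon> k"
      by (simp add: TT T_scale)
    then show ?thesis
      unfolding T[of "T (T \<epsilon>)"] T[of "T \<epsilon>"] by (simp add: algebra_simps power2_eq_square)
  qed
  have \<epsilon>0: "\<epsilon> 0 = 1" using assms by (simp add: \<epsilon>_def)
  have \<epsilon>m: "\<epsilon> (- 1) = 0" by (simp add: \<epsilon>_def)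
  have out: "T \<epsilon> k = 0" if "k < 0 \<or> int l \<le> k" for k
    using that by (auto simp: T \<epsilon>_def)
  define t where "t = T \<epsilon> 0"
  have T\<epsilon>: "T \<epsilon> k = t * \<epsilon> k" for k
  proof (cases "0 \<le> k \<and> k < int l")
    case True
    then have "T \<epsilon> k = T \<epsilon> 0 / \<epsilon> 0 * \<epsilon> k"
      using \<mu>0 \<epsilon>0 by (intro three_term_proportional[OF rec rec']) (auto simp: out \<epsilon>m)
    then show ?thesis by (simp add: \<epsilon>0 t_def)
  next
    case False
    then show ?thesis using out[of k] by (auto simp: \<epsilon>_def)
  qed
  have "t = \<mu> * \<epsilon> (int l - 1)" by (simp add: t_def T \<epsilon>_def)
  then have "0 < t" using pos[of "l - 1"] \<mu>0 assms by (simp add: \<epsilon>_def nat_diff_distrib)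
  moreover have "t\<^sup>2 = c\<^sup>2"
  proof -
    have "T \<epsilon> = (\<lambda>k. t * \<epsilon> k)" using T\<epsilon> by blast
    then have "T (T \<epsilon>) 0 = t * T \<epsilon> 0" using T_scale[of t \<epsilon> 0] by simp
    then show ?thesis using fun_cong[OF TT, of 0] by (simp add: \<epsilon>0 t_def power2_eq_square)
  qed
  ultimately have "t = c" using assms by (simp add: power2_eq_iff)
  then have "\<mu> * \<epsilon> (k - 1) = of_int k * \<epsilon> k + c * \<epsilon> (int l - k)" for k
    using T\<epsilon>[of "int l - k"] by (simp add: T algebra_simps)
  moreover have "\<epsilon> k > 0 \<longleftrightarrow> 0 \<le> k \<and> k < int l" "\<epsilon> k \<ge> 0" for k
    using pos[of "nat k"] by (simp_all add: \<epsilon>_def less_imp_le nat_less_iff)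
  ultimately have "heun_vector l c \<mu> \<epsilon>"
    unfolding heun_vector_def by simp
  then show ?thesis using \<mu> by blast
qed

text \<open>Collatz-Wielandt comparison at an index where the ratio of \<open>x\<close> to
  \<open>y\<close> is maximal: the matrix for \<open>c\<close> is entrywise at most \<open>s\<close>
  times the matrix for \<open>c'\<close>. Taking \<open>s = 1\<close> gives monotonicity of the
  eigenvalue in \<open>c\<close>, other values of \<open>s\<close> its continuity.\<close>

lemma heun_vector_compare:
  assumes x: "heun_vector l c \<mu> x" and y: "heun_vector l c' \<mu>' y"
    and "c \<le> s * c'" "1 \<le> s" "0 \<le> c'" "0 < l"
  shows "\<mu> \<le> s * \<mu>'"
proof -
  define K where "K = {0..<int l}"
  define r where "r = Max ((\<lambda>k. x k / y k) ` K)"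
  have fin: "finite K" "K \<noteq> {}" using \<open>0 < l\<close> by (auto simp: K_def)
  have pos: "0 < x k" "0 < y k" if "k \<in> K" for k
    using x y that by (auto simp: heun_vector_def K_def)
  have le: "x k \<le> r * y k" for k
  proof (cases "k \<in> K")
    case True
    then have "x k / y k \<le> r" using fin by (auto simp: r_def)
    then show ?thesis by (simp add: pos_divide_le_eq[OF pos(2)[OF True]])
  next
    case False
    then show ?thesis
      using heun_vector_zero[OF x, of k] heun_vector_zero[OF y, of k] by (auto simp: K_def)
  qed
  have "r \<in> (\<lambda>k. x k / y k) ` K"
    unfolding r_def by (rule Max_in) (use fin in auto)
  then obtain j where j: "j \<in> K" "r = x j / y j" by blast
  have r: "0 < r" using j pos[of j] by simp
  have y0: "0 \<le> y k" and x0: "0 \<le> x k" for k using x y by (auto simp: heun_vector_def)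
  have "\<mu> * x j = of_int (j + 1) * x (j + 1) + c * x (int l - (j + 1))"
    using x[unfolded heun_vector_def] by (metis add_diff_cancel_right')
  also have "\<dots> \<le> of_int (j + 1) * (s * (r * y (j + 1))) + s * c' * (r * y (int l - (j + 1)))"
  proof (rule add_mono)
    have "x (j + 1) \<le> 1 * (r * y (j + 1))" using le by simp
    also have "\<dots> \<le> s * (r * y (j + 1))"
      using \<open>1 \<le> s\<close> r y0 by (intro mult_right_mono) auto
    finally show "of_int (j + 1) * x (j + 1) \<le> of_int (j + 1) * (s * (r * y (j + 1)))"
      using j by (intro mult_left_mono) (auto simp: K_def)
    have "c * x (int l - (j + 1)) \<le> s * c' * x (int l - (j + 1))"
      using x0 assms by (intro mult_right_mono) auto
    also have "\<dots> \<le> s * c' * (r * y (int l - (j + 1)))"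
      using le assms by (intro mult_left_mono) auto
    finally show "c * x (int l - (j + 1)) \<le> s * c' * (r * y (int l - (j + 1)))" .
  qed
  also have "\<dots> = s * r * (of_int (j + 1) * y (j + 1) + c' * y (int l - (j + 1)))"
    by (simp add: algebra_simps)
  also have "of_int (j + 1) * y (j + 1) + c' * y (int l - (j + 1)) = \<mu>' * y j"
    using y[unfolded heun_vector_def] by (metis add_diff_cancel_right')
  also have "s * r * (\<mu>' * y j) = s * \<mu>' * x j"
    using j pos[of j] by simp
  finally show ?thesis using pos[of j] j by (simp add: mult_le_cancel_right)
qed

section \<open>Toeplitz determinants of modified Bessel functions\<close>

text \<open>The modified Bessel function \<open>I\<^sub>n(2t)\<close>, normalised so that
  \<open>exp (t (z + 1/z)) = \<Sum>\<^sub>n bessel n t z\<^sup>n\<close>.\<close>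
definition bessel :: "int \<Rightarrow> real \<Rightarrow> real" where
  "bessel n t = integral {0..2 * pi} (\<lambda>\<theta>. exp (2 * t * cos \<theta>) * cos (of_int n * \<theta>)) / (2 * pi)"

lemma bessel_integrand_continuous:
  "continuous_on A (\<lambda>\<theta>::real. exp (2 * t * cos \<theta>) * cos (of_int n * \<theta>))"
  by (intro continuous_intros)

lemma bessel_uminus: "bessel (- n) t = bessel n t"
  by (simp add: bessel_def)

lemma bessel_bound: "\<bar>bessel n t\<bar> \<le> exp (2 * \<bar>t\<bar>)"
proof -
  have "norm (integral {0..2 * pi} (\<lambda>\<theta>. exp (2 * t * cos \<theta>) * cos (of_int n * \<theta>)))
      \<le> exp (2 * \<bar>t\<bar>) * (2 * pi - 0)"
  proof (rule integral_bound)
    fix \<theta> :: real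
    have "2 * t * cos \<theta> \<le> \<bar>2 * t\<bar> * \<bar>cos \<theta>\<bar>"
      by (metis abs_ge_self abs_mult)
    also have "\<dots> \<le> \<bar>2 * t\<bar> * 1" by (intro mult_left_mono) auto
    finally have "exp (2 * t * cos \<theta>) * \<bar>cos (of_int n * \<theta>)\<bar> \<le> exp (2 * \<bar>t\<bar>) * 1"
      by (intro mult_mono) auto
    then show "norm (exp (2 * t * cos \<theta>) * cos (of_int n * \<theta>)) \<le> exp (2 * \<bar>t\<bar>)"
      by (simp add: abs_mult)
  qed (auto intro: bessel_integrand_continuous)
  then show ?thesis by (simp add: bessel_def field_simps)
qed

lemma bessel_at_0: "bessel n 0 = (if n = 0 then 1 else 0)"
proof (cases "n = 0")
  case False
  have "((\<lambda>\<theta>. cos (of_int n * \<theta>)) has_integral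
      (sin (of_int n * (2 * pi)) / of_int n - sin (of_int n * 0) / of_int n)) {0..2 * pi}"
    using False
    by (intro fundamental_theorem_of_calculus)
      (auto intro!: derivative_eq_intros simp: has_real_derivative_iff_has_vector_derivative[symmetric])
  moreover have "sin (of_int n * (2 * pi)) = (0::real)"
    using sin_int_2pin[of n] by (simp add: mult.commute)
  ultimately show ?thesis using False by (simp add: bessel_def integral_unique)
qed (simp add: bessel_def)

lemma bessel_derivative:
  "(bessel n has_real_derivative bessel (n - 1) t + bessel (n + 1) t) (at t)"
proof -
  have "((\<lambda>t. integral (cbox 0 (2 * pi)) (\<lambda>\<theta>. exp (2 * t * cos \<theta>) * cos (of_int n * \<theta>)))
     has_field_derivative
      integral (cbox 0 (2 * pi)) (\<lambda>\<theta>. 2 * cos \<theta> * exp (2 * t * cos \<theta>) * cos (of_int n * \<theta>)))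
      (at t within UNIV)"
  proof (rule leibniz_rule_field_derivative)
    show "continuous_on (UNIV \<times> cbox 0 (2 * pi))
        (\<lambda>(t, \<theta>). 2 * cos \<theta> * exp (2 * t * cos \<theta>) * cos (of_int n * \<theta>))"
      unfolding split_beta by (intro continuous_intros)
    show "(\<lambda>\<theta>. exp (2 * t * cos \<theta>) * cos (of_int n * \<theta>)) integrable_on cbox 0 (2 * pi)" for t :: real
      by (intro integrable_continuous bessel_integrand_continuous)
  qed (auto intro!: derivative_eq_intros)
  moreover have "2 * cos \<theta> * exp (2 * t * cos \<theta>) * cos (of_int n * \<theta>) =
      exp (2 * t * cos \<theta>) * cos (of_int (n - 1) * \<theta>) + exp (2 * t * cos \<theta>) * cos (of_int (n + 1) * \<theta>)"
    for \<theta>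
  proof -
    have "cos (of_int (n - 1) * \<theta>) + cos (of_int (n + 1) * \<theta>) = 2 * cos \<theta> * cos (of_int n * \<theta>)"
      by (simp add: algebra_simps cos_add cos_diff)
    then have "2 * cos \<theta> * exp (2 * t * cos \<theta>) * cos (of_int n * \<theta>) = exp (2 * t * cos \<theta>) *
        (cos (of_int (n - 1) * \<theta>) + cos (of_int (n + 1) * \<theta>))" by simp
    then show ?thesis by (simp only: distrib_left)
  qed
  moreover have "integral (cbox 0 (2 * pi)) (\<lambda>\<theta>. exp (2 * t * cos \<theta>) * cos (of_int (n - 1) * \<theta>)
        + exp (2 * t * cos \<theta>) * cos (of_int (n + 1) * \<theta>)) =
      integral (cbox 0 (2 * pi)) (\<lambda>\<theta>. exp (2 * t * cos \<theta>) * cos (of_int (n - 1) * \<theta>))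
      + integral (cbox 0 (2 * pi)) (\<lambda>\<theta>. exp (2 * t * cos \<theta>) * cos (of_int (n + 1) * \<theta>))"
    by (intro integral_add integrable_continuous bessel_integrand_continuous)
  ultimately have "((\<lambda>t. integral (cbox 0 (2 * pi)) (\<lambda>\<theta>. exp (2 * t * cos \<theta>) * cos (of_int n * \<theta>)))
     has_field_derivative
      integral (cbox 0 (2 * pi)) (\<lambda>\<theta>. exp (2 * t * cos \<theta>) * cos (of_int (n - 1) * \<theta>))
      + integral (cbox 0 (2 * pi)) (\<lambda>\<theta>. exp (2 * t * cos \<theta>) * cos (of_int (n + 1) * \<theta>))) (at t)"
    by simp
  from DERIV_cdivide[OF this, of "2 * pi"] show ?thesis
    by (simp add: bessel_def[abs_def] add_divide_distrib)
qed

lemma bessel_recurrence: "of_int n * bessel n t = t * (bessel (n - 1) t - bessel (n + 1) t)"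
proof -
  let ?e = "\<lambda>\<theta>. exp (2 * t * cos \<theta>)"
  have "((\<lambda>\<theta>. of_int n * (?e \<theta> * cos (of_int n * \<theta>)) - 2 * t * sin \<theta> * ?e \<theta> * sin (of_int n * \<theta>))
      has_integral (?e (2 * pi) * sin (of_int n * (2 * pi)) - ?e 0 * sin (of_int n * 0))) {0..2 * pi}"
    by (intro fundamental_theorem_of_calculus)
      (auto intro!: derivative_eq_intros simp: has_real_derivative_iff_has_vector_derivative[symmetric])
  moreover have "sin (of_int n * (2 * pi)) = (0::real)"
    using sin_int_2pin[of n] by (simp add: mult.commute)
  moreover have "2 * t * sin \<theta> * ?e \<theta> * sin (of_int n * \<theta>) =
      t * (?e \<theta> * cos (of_int (n - 1) * \<theta>)) - t * (?e \<theta> * cos (of_int (n + 1) * \<theta>))" for \<theta>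
  proof -
    have "cos (of_int (n - 1) * \<theta>) - cos (of_int (n + 1) * \<theta>) = 2 * sin \<theta> * sin (of_int n * \<theta>)"
      by (simp add: algebra_simps cos_add cos_diff)
    then have "2 * t * sin \<theta> * ?e \<theta> * sin (of_int n * \<theta>) =
        t * ?e \<theta> * (cos (of_int (n - 1) * \<theta>) - cos (of_int (n + 1) * \<theta>))" by simp
    then show ?thesis by (simp add: algebra_simps)
  qed
  ultimately have zero: "((\<lambda>\<theta>. of_int n * (?e \<theta> * cos (of_int n * \<theta>)) -
      (t * (?e \<theta> * cos (of_int (n - 1) * \<theta>)) - t * (?e \<theta> * cos (of_int (n + 1) * \<theta>)))) has_integral 0)
      {0..2 * pi}"
    by simp
  have int: "((\<lambda>\<theta>. ?e \<theta> * cos (of_int k * \<theta>)) has_integral (2 * pi * bessel k t)) {0..2 * pi}" for k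
    using integrable_integral[OF integrable_continuous_interval[OF bessel_integrand_continuous]]
    by (simp add: bessel_def)
  have "((\<lambda>\<theta>. of_int n * (?e \<theta> * cos (of_int n * \<theta>)) -
      (t * (?e \<theta> * cos (of_int (n - 1) * \<theta>)) - t * (?e \<theta> * cos (of_int (n + 1) * \<theta>)))) has_integral
      (of_int n * (2 * pi * bessel n t) - (t * (2 * pi * bessel (n - 1) t) - t * (2 * pi * bessel (n + 1) t))))
      {0..2 * pi}"
    by (intro has_integral_diff has_integral_mult_right int)
  from has_integral_unique[OF zero this]
  have "2 * pi * (of_int n * bessel n t - t * (bessel (n - 1) t - bessel (n + 1) t)) = 0"
    by (simp add: algebra_simps)
  then show ?thesis by simp
qed

text \<open>The recurrence bounds \<open>n * bessel n t\<close> uniformly in \<open>n\<close>, which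
  yields decay of order 1/n.\<close>

lemma bessel_tendsto_0: "(\<lambda>k::nat. bessel (a + int k) t) \<longlonglongrightarrow> 0"
proof (rule Lim_null_comparison)
  define C where "C = 2 * \<bar>t\<bar> * exp (2 * \<bar>t\<bar>)"
  have bound: "\<bar>of_int n * bessel n t\<bar> \<le> C" for n
  proof -
    have "\<bar>of_int n * bessel n t\<bar> \<le> \<bar>t\<bar> * (\<bar>bessel (n - 1) t\<bar> + \<bar>bessel (n + 1) t\<bar>)"
      unfolding bessel_recurrence abs_mult by (intro mult_left_mono abs_triangle_ineq4) auto
    also have "\<dots> \<le> \<bar>t\<bar> * (exp (2 * \<bar>t\<bar>) + exp (2 * \<bar>t\<bar>))"
      by (intro mult_left_mono add_mono bessel_bound) auto
    finally show ?thesis by (simp add: C_def)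
  qed
  show "\<forall>\<^sub>F k in sequentially. norm (bessel (a + int k) t) \<le> C / (of_int a + real k)"
    using eventually_gt_at_top[of "nat (- a)"]
  proof eventually_elim
    case (elim k)
    then have pos: "0 < real_of_int a + real k" by linarith
    then have "norm (bessel (a + int k) t) * (of_int a + real k) \<le> C"
      using bound[of "a + int k"] by (simp add: abs_mult mult.commute)
    then show ?case using pos by (simp add: pos_le_divide_eq)
  qed
  show "(\<lambda>k. C / (of_int a + real k)) \<longlonglongrightarrow> 0"
    by (intro tendsto_divide_0[OF tendsto_const] filterlim_at_top_imp_at_infinity
        filterlim_tendsto_add_at_top[OF tendsto_const] filterlim_real_sequentially)
qed

text \<open>The columns are always 0 to l - 1 but the row indices are arbitrary, so that the family
  is closed under differentiation in \<open>t\<close>. Up to normalisation these are the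
  Karlin-McGregor determinants of nonintersecting walks.\<close>

definition bessel_minor :: "nat \<Rightarrow> (nat \<Rightarrow> int) \<Rightarrow> real \<Rightarrow> real" where
  "bessel_minor l i t = det (mat l l (\<lambda>(r, c). bessel (i r - int c) t))"

lemma bessel_minor_sum:
  "bessel_minor l i t =
    (\<Sum>p | p permutes {0..<l}. signof p * (\<Prod>r = 0..<l. bessel (i r - int (p r)) t))"
proof -
  have "(\<Prod>r = 0..<l. mat l l (\<lambda>(r, c). bessel (i r - int c) t) $$ (r, p r)) =
      (\<Prod>r = 0..<l. bessel (i r - int (p r)) t)" if "p permutes {0..<l}" for p
    using permutes_in_image[OF that] by (intro prod.cong) auto
  then show ?thesis
    unfolding bessel_minor_def det_def by (auto intro!: sum.cong)
qed

text \<open>As the derivative of \<open>bessel n\<close> is the sum of its two neighbours,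
  multilinearity in the rows produces all moves of a single row by one step.\<close>

lemma bessel_minor_derivative:
  "(bessel_minor l i has_real_derivative
    (\<Sum>r<l. bessel_minor l (i(r := i r - 1)) t + bessel_minor l (i(r := i r + 1)) t)) (at t)"
proof -
  let ?P = "{p. p permutes {0..<l}}"
  let ?b = "\<lambda>p r. bessel (i r - int (p r)) t"
  have split: "(\<Prod>s = 0..<l. bessel ((i(r := x)) s - int (p s)) t) =
      bessel (x - int (p r)) t * (\<Prod>s \<in> {0..<l} - {r}. ?b p s)" if "r < l" for p r x
    using that by (subst prod.remove[of _ r]) auto
  have "(\<Sum>r<l. bessel_minor l (i(r := i r - 1)) t + bessel_minor l (i(r := i r + 1)) t) =
      (\<Sum>r<l. \<Sum>p\<in>?P. signof p * ((bessel (i r - int (p r) - 1) t + bessel (i r - int (p r) + 1) t) *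
        (\<Prod>s \<in> {0..<l} - {r}. ?b p s)))"
    unfolding bessel_minor_sum sum.distrib[symmetric]
    by (intro sum.cong refl) (auto simp: split algebra_simps simp del: fun_upd_apply)
  also have "\<dots> = (\<Sum>p\<in>?P. signof p * (\<Sum>r = 0..<l. (bessel (i r - int (p r) - 1) t + bessel (i r - int (p r) + 1) t) *
        (\<Prod>s \<in> {0..<l} - {r}. ?b p s)))"
    unfolding sum_distrib_left lessThan_atLeast0 by (rule sum.swap)
  finally have eq: "(\<Sum>r<l. bessel_minor l (i(r := i r - 1)) t + bessel_minor l (i(r := i r + 1)) t) = \<dots>" .
  have "((\<lambda>t. \<Sum>p\<in>?P. signof p * (\<Prod>r = 0..<l. bessel (i r - int (p r)) t)) has_real_derivative
      (\<Sum>p\<in>?P. signof p * (\<Sum>r = 0..<l. (bessel (i r - int (p r) - 1) t + bessel (i r - int (p r) + 1) t) *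
        (\<Prod>s \<in> {0..<l} - {r}. ?b p s)))) (at t)"
    by (intro DERIV_sum DERIV_cmult has_field_derivative_prod bessel_derivative)
  moreover have "bessel_minor l i = (\<lambda>t. \<Sum>p\<in>?P. signof p * (\<Prod>r = 0..<l. bessel (i r - int (p r)) t))"
    by (simp add: bessel_minor_sum fun_eq_iff)
  ultimately show ?thesis by (simp only: eq)
qed

lemma bessel_minor_bound: "\<bar>bessel_minor l i t\<bar> \<le> fact l * exp (2 * \<bar>t\<bar>) ^ l"
proof -
  have "\<bar>bessel_minor l i t\<bar> \<le> (\<Sum>p | p permutes {0..<l}. exp (2 * \<bar>t\<bar>) ^ l)"
    unfolding bessel_minor_sum
  proof (rule order_trans[OF sum_abs], rule sum_mono)
    fix p
    have "\<bar>\<Prod>r = 0..<l. bessel (i r - int (p r)) t\<bar> \<le> (\<Prod>r = 0..<l. exp (2 * \<bar>t\<bar>))"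
      unfolding abs_prod by (intro prod_mono) (auto intro: bessel_bound)
    then show "\<bar>signof p * (\<Prod>r = 0..<l. bessel (i r - int (p r)) t)\<bar> \<le> exp (2 * \<bar>t\<bar>) ^ l"
      by (simp add: abs_mult sign_def)
  qed
  also have "\<dots> = fact l * exp (2 * \<bar>t\<bar>) ^ l"
    by (simp add: card_permutations)
  finally show ?thesis .
qed

lemma bessel_minor_eq_rows:
  assumes "r < l" "s < l" "r \<noteq> s" "i r = i s"
  shows "bessel_minor l i t = 0"
  unfolding bessel_minor_def
proof (rule det_identical_rows[OF _ \<open>r \<noteq> s\<close> \<open>r < l\<close> \<open>s < l\<close>])
  show "row (mat l l (\<lambda>(r, c). bessel (i r - int c) t)) r = row (mat l l (\<lambda>(r, c). bessel (i r - int c) t)) s"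
    using assms by (intro eq_vecI) auto
qed auto

lemma bessel_minor_at_0:
  assumes "strict_mono_on {..<l} i"
  shows "bessel_minor l i 0 = (if \<forall>r<l. i r = int r then 1 else 0)"
proof (cases "\<forall>r<l. i r = int r")
  case True
  have "mat l l (\<lambda>(r, c). bessel (i r - int c) 0) = 1\<^sub>m l"
    using True by (intro eq_matI) (auto simp: bessel_at_0)
  then show ?thesis using True by (simp add: bessel_minor_def)
next
  case False
  \<comment> \<open>A strictly increasing map into the column indices would be the identity. So some
    row index lies outside them, and that row is zero at time 0.\<close>
  have "\<exists>r<l. i r \<notin> int ` {..<l}"
  proof (rule ccontr)
    assume "\<not> ?thesis"
    then have sub: "i ` {..<l} \<subseteq> int ` {..<l}" by auto
    have inj: "inj_on i {..<l}" using assms strict_mono_on_imp_inj_on by blast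
    have eq: "i ` {..<l} = int ` {..<l}"
      using sub inj by (intro card_subset_eq) (auto simp: card_image)
    have "i r = int r" if "r < l" for r
      using that
    proof (induction r rule: less_induct)
      case (less r)
      obtain s where s: "s < l" "i s = int r" using eq less.prems by (metis image_iff lessThan_iff)
      have "\<not> s < r" using less.IH[of s] s by auto
      moreover have "\<not> r < s"
      proof
        assume "r < s"
        then have "i r < int r" using assms s less.prems by (metis lessThan_iff strict_mono_onD)
        moreover obtain q where "q < l" "i r = int q" using eq less.prems by (metis image_iff lessThan_iff)
        ultimately have "q < r" by simp
        then have "i q = i r" using less.IH[of q] \<open>q < l\<close> \<open>i r = int q\<close> by simp
        then show False using \<open>q < r\<close> \<open>q < l\<close> less.prems inj by (metis inj_on_eq_iff lessThan_iff less_irrefl)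
      qed
      ultimately show ?case using s by (metis linorder_neqE_nat)
    qed
    then show False using False by blast
  qed
  then obtain r where r: "r < l" "i r \<notin> int ` {..<l}" by blast
  have *: "(\<Prod>r = 0..<l. bessel (i r - int (p r)) 0) = 0" if "p permutes {0..<l}" for p
  proof -
    have "p r < l" using permutes_in_image[OF that, of r] r by simp
    then have "bessel (i r - int (p r)) 0 = 0" using r by (auto simp: bessel_at_0)
    then show ?thesis using r by (intro prod_zero) auto
  qed
  have "bessel_minor l i 0 = 0"
    unfolding bessel_minor_sum
    by (intro sum.neutral ballI) (simp only: mem_Collect_eq * mult_zero_right)
  then show ?thesis using False by simp
qed

text \<open>A unit step cannot overtake another row, only land on it, and then two rows agree. So
  the derivative of a minor with increasing rows involves, besides zeros, only minors of the same
  kind.\<close>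

lemma neighbour_cases:
  assumes i: "strict_mono_on {..<l} i" and "r < l" "d = 1 \<or> d = -1"
  obtains (strict) "strict_mono_on {..<l} (i(r := i r + d))"
    | (eq) s where "s < l" "s \<noteq> r" "i s = i r + (d::int)"
proof (cases "\<exists>s<l. s \<noteq> r \<and> i s = i r + d")
  case False
  have "strict_mono_on {..<l} (i(r := i r + d))"
  proof (rule strict_mono_onI)
    fix a b assume ab: "a \<in> {..<l}" "b \<in> {..<l}" "a < b"
    have "i a < i b" using strict_mono_onD[OF i] ab by blast
    then show "(i(r := i r + d)) a < (i(r := i r + d)) b"
      using False ab assms by (cases "a = r"; cases "b = r") force+
  qed
  then show thesis by (rule strict)
qed (use eq in blast)

text \<open>The family is infinite, so there is no smallest minor to which a maximum principle could
  be applied. Instead the crude bound \<open>- C\<close> is improved by repeated integration: the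
  initial values are nonnegative and the derivative is a sum of \<open>2 * l\<close> neighbours, so
  that round \<open>n\<close> gains a factor \<open>2 * l * t / n\<close>.\<close>

lemma bessel_minor_lower_bound:
  assumes "strict_mono_on {..<l} i" "0 \<le> t" "t \<le> T" "\<And>i s. 0 \<le> s \<Longrightarrow> s \<le> T \<Longrightarrow> \<bar>bessel_minor l i s\<bar> \<le> C"
    "0 \<le> C"
  shows "- C * (2 * real l * t) ^ n / fact n \<le> bessel_minor l i t"
  using assms(1-3)
proof (induction n arbitrary: i t)
  case 0
  then show ?case using assms(4)[of t i] by (simp add: abs_le_iff)
next
  case (Suc n)
  let ?g = "\<lambda>s. bessel_minor l i s + C * (2 * real l * s) ^ Suc n / fact (Suc n)"
  have "?g 0 \<le> ?g t"
  proof (rule DERIV_nonneg_imp_nondecreasing[OF \<open>0 \<le> t\<close>], intro exI conjI)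
    fix s assume s: "0 \<le> s" "s \<le> t"
    let ?q = "C * (2 * real l * s) ^ n / fact n"
    have "((\<lambda>s. C * (2 * real l * s) ^ Suc n / fact (Suc n)) has_real_derivative
        C * (real (Suc n) * (2 * real l * s) ^ n * (2 * real l)) / fact (Suc n)) (at s)"
      by (auto intro!: derivative_eq_intros simp del: power_Suc fact_Suc)
    also have "C * (real (Suc n) * (2 * real l * s) ^ n * (2 * real l)) / fact (Suc n) = 2 * real l * ?q"
      by (simp add: field_simps del: of_nat_Suc)
    finally show "(?g has_real_derivative
        (\<Sum>r<l. bessel_minor l (i(r := i r - 1)) s + bessel_minor l (i(r := i r + 1)) s)
        + 2 * real l * ?q) (at s)"
      by (intro DERIV_add bessel_minor_derivative)
    have q: "0 \<le> ?q" using s \<open>0 \<le> C\<close> by simp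
    have "- ?q \<le> bessel_minor l (i(r := i r + d)) s" if "r < l" "d = 1 \<or> d = -1" for r d
      using Suc.prems(1) that
    proof (cases rule: neighbour_cases)
      case strict
      then show ?thesis using Suc.IH[OF strict, of s] s Suc.prems by (simp del: fun_upd_apply)
    next
      case (eq s')
      then have "bessel_minor l (i(r := i r + d)) s = 0"
        using that by (intro bessel_minor_eq_rows[of r l s']) auto
      then show ?thesis using q by simp
    qed
    from this[of _ "-1"] this[of _ 1]
    have "(\<Sum>r<l. - ?q + - ?q) \<le>
        (\<Sum>r<l. bessel_minor l (i(r := i r - 1)) s + bessel_minor l (i(r := i r + 1)) s)"
      by (intro sum_mono add_mono) auto
    then show "0 \<le> (\<Sum>r<l. bessel_minor l (i(r := i r - 1)) s + bessel_minor l (i(r := i r + 1)) s)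
        + 2 * real l * ?q"
      by (simp add: algebra_simps)
  qed
  moreover have "0 \<le> ?g 0" using bessel_minor_at_0[OF Suc.prems(1)] by simp
  ultimately show ?case by (simp only: minus_mult_left[symmetric] minus_divide_left[symmetric])
qed

lemma bessel_minor_nonneg:
  assumes "strict_mono_on {..<l} i" "0 \<le> t"
  shows "0 \<le> bessel_minor l i t"
proof (rule LIMSEQ_le_const2)
  define C where "C = fact l * exp (2 * \<bar>t\<bar>) ^ l"
  have "\<bar>bessel_minor l i s\<bar> \<le> C" if "0 \<le> s" "s \<le> t" for i s
  proof -
    have "fact l * exp (2 * \<bar>s\<bar>) ^ l \<le> C"
      unfolding C_def using that by (intro mult_left_mono power_mono) auto
    then show ?thesis using bessel_minor_bound order_trans by blast
  qed
  then show "\<exists>N. \<forall>n\<ge>N. - C * (2 * real l * t) ^ n / fact n \<le> bessel_minor l i t"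
    using assms by (intro exI allI impI bessel_minor_lower_bound[of _ _ _ t]) (auto simp: C_def)
  have "(\<lambda>n. (2 * real l * t) ^ n / fact n) \<longlonglongrightarrow> 0"
    using summable_LIMSEQ_zero[OF summable_exp[of "2 * real l * t"]] by (simp add: field_simps)
  from tendsto_mult_right_zero[OF this, of "- C"]
  show "(\<lambda>n. - C * (2 * real l * t) ^ n / fact n) \<longlonglongrightarrow> 0" by simp
qed


lemma bessel_minor_derivative_ge:
  assumes i: "strict_mono_on {..<l} i" and "0 \<le> t" "r < l" "d = 1 \<or> d = -1"
  shows "bessel_minor l (i(r := i r + d)) t \<le>
    (\<Sum>r<l. bessel_minor l (i(r := i r - 1)) t + bessel_minor l (i(r := i r + 1)) t)"
proof -
  have nonneg: "0 \<le> bessel_minor l (i(r := i r + d)) t" if "r < l" "d = 1 \<or> d = -1" for r d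
    using i that
  proof (cases rule: neighbour_cases)
    case strict
    then show ?thesis using \<open>0 \<le> t\<close> by (rule bessel_minor_nonneg)
  next
    case (eq s')
    then have "bessel_minor l (i(r := i r + d)) t = 0"
      using that by (intro bessel_minor_eq_rows[of r l s']) auto
    then show ?thesis by simp
  qed
  have "bessel_minor l (i(r := i r + d)) t \<le>
      bessel_minor l (i(r := i r - 1)) t + bessel_minor l (i(r := i r + 1)) t"
    using nonneg[OF \<open>r < l\<close>, of "-1"] nonneg[OF \<open>r < l\<close>, of 1] \<open>d = 1 \<or> d = -1\<close>
    by (auto simp del: fun_upd_apply)
  also have "\<dots> \<le> (\<Sum>r<l. bessel_minor l (i(r := i r - 1)) t + bessel_minor l (i(r := i r + 1)) t)"
    using nonneg[of _ "-1"] nonneg[of _ 1] \<open>r < l\<close>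
    by (intro member_le_sum) (auto simp del: fun_upd_apply intro!: add_nonneg_nonneg)
  finally show ?thesis .
qed

lemma bessel_minor_mono:
  assumes i: "strict_mono_on {..<l} i" and "0 \<le> s" "s \<le> t"
  shows "bessel_minor l i s \<le> bessel_minor l i t"
proof (cases "l = 0")
  case True
  then show ?thesis by (simp add: bessel_minor_def det_def)
next
  case False
  show ?thesis
  proof (rule DERIV_nonneg_imp_nondecreasing[OF \<open>s \<le> t\<close>], intro exI conjI)
    fix u assume u: "s \<le> u"
    show "(bessel_minor l i has_real_derivative
      (\<Sum>r<l. bessel_minor l (i(r := i r - 1)) u + bessel_minor l (i(r := i r + 1)) u)) (at u)"
      by (rule bessel_minor_derivative)
    have u0: "0 \<le> u" using u \<open>0 \<le> s\<close> by simp
    \<comment> \<open>Lowering the first row never meets another one, so a nonnegative neighbour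
      bounding the derivative from below is always at hand.\<close>
    have "i 0 + - 1 < i r" if "r < l" for r
      using strict_mono_onD[OF i, of 0 r] that by (cases "r = 0") auto
    then have "strict_mono_on {..<l} (i(0 := i 0 + - 1))"
      using strict_mono_onD[OF i] by (intro strict_mono_onI) auto
    from bessel_minor_nonneg[OF this u0] bessel_minor_derivative_ge[OF i u0, of 0 "-1"] False
    show "0 \<le> (\<Sum>r<l. bessel_minor l (i(r := i r - 1)) u + bessel_minor l (i(r := i r + 1)) u)"
      by (simp del: fun_upd_apply)
  qed
qed

text \<open>The rows \<open>0, \<dots>, l - 1\<close> are moved up by one step each, the last one first.\<close>
lemma bessel_minor_shifted_pos:
  assumes "k \<le> l" "0 < t"
  shows "0 < bessel_minor l (\<lambda>r. if r < l - k then int r else int r + 1) t"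
  using assms
proof (induction k arbitrary: t)
  case 0
  define i where "i = (\<lambda>r. if r < l - 0 then int r else int r + 1)"
  have i: "strict_mono_on {..<l} i" by (auto simp: i_def intro: strict_mono_onI)
  have "bessel_minor l i 0 = 1"
    unfolding bessel_minor_at_0[OF i] by (simp add: i_def)
  moreover have "bessel_minor l i 0 \<le> bessel_minor l i t"
    using 0 by (intro bessel_minor_mono[OF i]) auto
  ultimately show ?case by (simp add: i_def)
next
  case (Suc k)
  define i where "i = (\<lambda>k r. if r < l - k then int r else int r + 1)"
  define q where "q = l - Suc k"
  have q: "q < l" using Suc.prems by (simp add: q_def)
  have i: "strict_mono_on {..<l} (i (Suc k))" by (auto simp: i_def intro: strict_mono_onI)
  \<comment> \<open>Row \<open>q\<close> is the one shifted last. Lowering it restores the pattern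
    with \<open>k\<close> shifted rows, whose minor, positive by induction, bounds the derivative
    from below.\<close>
  have upd: "(i (Suc k))(q := i (Suc k) q + - 1) = i k"
    using Suc.prems by (auto simp: i_def q_def fun_eq_iff)
  have "bessel_minor l (i (Suc k)) 0 < bessel_minor l (i (Suc k)) t"
  proof (rule DERIV_pos_imp_increasing_open[OF \<open>0 < t\<close>])
    fix u assume u: "0 < u" "u < t"
    let ?D = "\<Sum>r<l. bessel_minor l ((i (Suc k))(r := i (Suc k) r - 1)) u
      + bessel_minor l ((i (Suc k))(r := i (Suc k) r + 1)) u"
    have "0 < bessel_minor l (i k) u"
      using Suc.IH[of u] Suc.prems u by (simp add: i_def)
    also have "\<dots> \<le> ?D"
      using bessel_minor_derivative_ge[OF i _ q, of u "-1"] u unfolding upd by simp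
    finally show "\<exists>D. (bessel_minor l (i (Suc k)) has_real_derivative D) (at u) \<and> 0 < D"
      using bessel_minor_derivative by blast
  next
    show "continuous_on {0..t} (bessel_minor l (i (Suc k)))"
      by (intro DERIV_continuous_on[OF has_field_derivative_at_within[OF bessel_minor_derivative]])
  qed
  moreover have "0 \<le> bessel_minor l (i (Suc k)) 0"
    by (simp add: bessel_minor_at_0[OF i])
  ultimately show ?case by (simp add: i_def)
qed

text \<open>This uses the pattern with all rows shifted: in the application the vanishing
  coefficients have the indices 1 to l, one higher than the columns.\<close>

lemma bessel_toeplitz_injective:
  assumes "0 < t" and zero: "\<And>n. 1 \<le> n \<Longrightarrow> n \<le> int l \<Longrightarrow> (\<Sum>j<l. v j * bessel (n - int j) t) = 0"
    and "j < l"
  shows "v j = (0 :: real)"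
proof -
  define A where "A = mat l l (\<lambda>(r, c). bessel (int r + 1 - int c) t)"
  have "0 < det A"
    using bessel_minor_shifted_pos[of l l t] \<open>0 < t\<close> by (simp add: bessel_minor_def A_def)
  then have det: "det A \<noteq> 0" by simp
  have A: "A \<in> carrier_mat l l" by (simp add: A_def)
  have "A *\<^sub>v vec l v = 0\<^sub>v l"
  proof (rule eq_vecI)
    fix r assume r: "r < dim_vec (0\<^sub>v l)"
    then have "(A *\<^sub>v vec l v) $ r = (\<Sum>j<l. v j * bessel (int r + 1 - int j) t)"
      by (auto simp: A_def scalar_prod_def lessThan_atLeast0 mult.commute intro!: sum.cong)
    then show "(A *\<^sub>v vec l v) $ r = 0\<^sub>v l $ r"
      using zero[of "int r + 1"] r by simp
  qed (simp add: A_def)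
  then have "vec l v = 0\<^sub>v l"
    using det_0_iff_vec_prod_zero_field[OF A] det by (metis vec_carrier)
  then show ?thesis using \<open>j < l\<close> by (metis index_vec index_zero_vec(1))
qed

section \<open>The linear system and its Fourier coefficients\<close>

text \<open>The sequence \<open>M\<close> obeys an adjoint relation, so that a pairing of
  \<open>y\<close> with \<open>M\<close> is constant in \<open>k\<close>; boundedness of
  \<open>y\<close> and decay of \<open>M\<close> make it 0. Read at \<open>k = l\<close>, this
  forces \<open>y\<close> to vanish at \<open>l\<close> and at -1. In between \<open>y\<close> is a
  multiple of \<open>\<epsilon>\<close>, and the reversed sign of \<open>c\<close> leaves only
  0.\<close>

lemma bounded_anti_heun_sequence_vanishes:
  fixes y :: "int \<Rightarrow> real"
  assumes \<epsilon>: "heun_vector l c \<mu> \<epsilon>" and "0 < l" "0 < c" "0 < \<mu>"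
    and y: "\<And>k. \<mu> * y (k - 1) = of_int k * y k + - c * y (int l - k)"
    and bound: "\<And>k. \<bar>y k\<bar> \<le> C" and "0 \<le> k" "k < int l"
  shows "y k = 0"
proof -
  define s where "s = (\<lambda>n::int. if even n then 1 else - 1 :: real)"
  \<comment> \<open>These are the Laurent coefficients of exp (- \<mu> (z + 1/z)); those of its
    product with the polynomial with coefficients \<open>\<epsilon>\<close> are
    \<open>M\<close>.\<close>
  define J where "J = (\<lambda>n. s n * bessel n \<mu>)"
  define M where "M = (\<lambda>n. \<Sum>j<l. \<epsilon> (int j) * J (n - int j))"
  have rel: "\<mu> * \<epsilon> (k - 1) = of_int k * \<epsilon> k + c * \<epsilon> (int l - k)" for k
    using \<epsilon> by (simp add: heun_vector_def)
  have pos: "0 < \<epsilon> k" if "0 \<le> k" "k < int l" for k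
    using \<epsilon> that by (simp add: heun_vector_def)
  have out: "\<epsilon> k = 0" if "k < 0 \<or> int l \<le> k" for k
    using heun_vector_zero[OF \<epsilon> that] .
  have J_rec: "of_int n * J n = \<mu> * (J (n + 1) - J (n - 1))" for n
    using bessel_recurrence[of n \<mu>] by (auto simp: J_def s_def algebra_simps)
  have J_even: "J (- n) = J n" for n
    by (simp add: J_def s_def bessel_uminus)
  have M_rel: "of_int n * M n = \<mu> * M (n + 1) - c * M (int l - n)" for n
  proof -
    have "of_int n * M n = (\<Sum>j<l. (of_int (int j) * \<epsilon> (int j)) * J (n - int j)) +
        (\<Sum>j<l. \<epsilon> (int j) * (of_int (n - int j) * J (n - int j)))"
      unfolding M_def sum_distrib_left sum.distrib[symmetric]
      by (intro sum.cong refl) (simp add: algebra_simps)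
    also have "(\<Sum>j<l. \<epsilon> (int j) * (of_int (n - int j) * J (n - int j))) = \<mu> * M (n + 1) - \<mu> * M (n - 1)"
      unfolding J_rec M_def sum_distrib_left sum_subtractf[symmetric]
      by (intro sum.cong refl) (simp add: algebra_simps)
    also have "(\<Sum>j<l. (of_int (int j) * \<epsilon> (int j)) * J (n - int j)) =
        (\<Sum>j<Suc l. (of_int (int j) * \<epsilon> (int j)) * J (n - int j))"
      by (simp add: out)
    also have "\<dots> = (\<Sum>j<Suc l. \<mu> * \<epsilon> (int j - 1) * J (n - int j)) - (\<Sum>j<Suc l. c * \<epsilon> (int l - int j) * J (n - int j))"
      unfolding rel sum_subtractf[symmetric] by (intro sum.cong refl) (simp add: algebra_simps)
    also have "(\<Sum>j<Suc l. \<mu> * \<epsilon> (int j - 1) * J (n - int j)) = \<mu> * M (n - 1)"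
      unfolding sum.lessThan_Suc_shift M_def sum_distrib_left
      by (simp add: out algebra_simps)
    also have "(\<Sum>j<Suc l. c * \<epsilon> (int l - int j) * J (n - int j)) = c * M (int l - n)"
    proof -
      have "(\<Sum>j<Suc l. c * \<epsilon> (int l - int j) * J (n - int j)) =
          (\<Sum>j<Suc l. c * \<epsilon> (int j) * J (n - int l + int j))"
        by (rule sum.reindex_bij_witness[of _ "\<lambda>j. l - j" "\<lambda>j. l - j"]) (auto simp: of_nat_diff)
      also have "\<dots> = (\<Sum>j<l. c * \<epsilon> (int j) * J (n - int l + int j))"
        by (simp add: out)
      also have "\<dots> = c * M (int l - n)"
        unfolding M_def sum_distrib_left
      proof (intro sum.cong refl)
        fix j
        show "c * \<epsilon> (int j) * J (n - int l + int j) = c * (\<epsilon> (int j) * J (int l - n - int j))"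
        proof -
          have "n - int l + int j = - (int l - n - int j)" by simp
          then show ?thesis by (simp only: J_even mult.assoc)
        qed
      qed
      finally show ?thesis .
    qed
    finally show ?thesis by simp
  qed
  have J_lim: "(\<lambda>k. J (a + int k)) \<longlonglongrightarrow> 0" for a
  proof (rule Lim_null_comparison)
    show "(\<lambda>k. \<bar>bessel (a + int k) \<mu>\<bar>) \<longlonglongrightarrow> 0"
      using bessel_tendsto_0[of a \<mu>] by (rule tendsto_rabs_zero)
    show "\<forall>\<^sub>F k in sequentially. norm (J (a + int k)) \<le> \<bar>bessel (a + int k) \<mu>\<bar>"
      by (intro always_eventually allI) (simp add: J_def s_def abs_mult)
  qed
  have M_lim: "(\<lambda>k. M (a + int k)) \<longlonglongrightarrow> 0" "(\<lambda>k. M (a - int k)) \<longlonglongrightarrow> 0" for a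
  proof -
    have "(\<lambda>k. \<Sum>j<l. \<epsilon> (int j) * J ((a - int j) + int k)) \<longlonglongrightarrow> 0"
      by (intro tendsto_null_sum tendsto_mult_right_zero J_lim)
    then show "(\<lambda>k. M (a + int k)) \<longlonglongrightarrow> 0"
      by (simp add: M_def algebra_simps)
    have "(\<lambda>k. \<Sum>j<l. \<epsilon> (int j) * J ((int j - a) + int k)) \<longlonglongrightarrow> 0"
      by (intro tendsto_null_sum tendsto_mult_right_zero J_lim)
    moreover have "J ((int j - a) + int k) = J (a - int k - int j)" for j k
      using J_even[of "(int j - a) + int k"] by (simp add: algebra_simps)
    ultimately show "(\<lambda>k. M (a - int k)) \<longlonglongrightarrow> 0"
      by (simp add: M_def)
  qed
  define P where "P = (\<lambda>k. y k * M (k + 1))"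
  \<comment> \<open>The increment of \<open>P\<close> at \<open>k\<close> is invariant under
    replacing \<open>k\<close> by \<open>l - k\<close>, so it cancels against that of the reflected
    copy.\<close>
  define Z where "Z = (\<lambda>k. P k + P (int l - 1 - k))"
  have "P k - P (k - 1) = P (int l - k) - P (int l - k - 1)" for k
  proof -
    have step: "\<mu> * (P k - P (k - 1)) = c * (y (int l - k) * M k + y k * M (int l - k))" for k
    proof -
      have "\<mu> * P (k - 1) = (of_int k * y k + - c * y (int l - k)) * M k"
        unfolding y[symmetric] by (simp add: P_def)
      moreover have "\<mu> * P k = y k * (of_int k * M k + c * M (int l - k))"
        unfolding M_rel by (simp add: P_def)
      ultimately show ?thesis by (simp add: algebra_simps)
    qed
    have "\<mu> * (P k - P (k - 1)) = \<mu> * (P (int l - k) - P (int l - k - 1))"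
      unfolding step by (simp add: add.commute)
    then show ?thesis using \<open>0 < \<mu>\<close> by simp
  qed
  note P_step = this
  have Z_step: "Z k = Z (k - 1)" for k
  proof -
    have e: "int l - 1 - (k - 1) = int l - k" "int l - 1 - k = int l - k - 1" by simp_all
    show ?thesis using P_step[of k] unfolding Z_def e by simp
  qed
  have Z_const: "Z (k + int n) = Z k" for k n
  proof (induction n)
    case (Suc n)
    then show ?case using Z_step[of "k + int (Suc n)"] by (simp add: algebra_simps)
  qed simp
  have yM: "(\<lambda>n. y (f n) * g n) \<longlonglongrightarrow> 0" if g: "g \<longlonglongrightarrow> 0" for f and g :: "nat \<Rightarrow> real"
  proof (rule Lim_null_comparison)
    show "\<forall>\<^sub>F n in sequentially. norm (y (f n) * g n) \<le> C * \<bar>g n\<bar>"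
      by (intro always_eventually allI) (simp add: abs_mult bound mult_right_mono)
    show "(\<lambda>n. C * \<bar>g n\<bar>) \<longlonglongrightarrow> 0"
      using g by (intro tendsto_mult_right_zero tendsto_rabs_zero)
  qed
  have "(\<lambda>n. Z (int l + int n)) \<longlonglongrightarrow> 0 + 0"
    unfolding Z_def P_def
  proof (intro tendsto_add yM)
    show "(\<lambda>n. M (int l + int n + 1)) \<longlonglongrightarrow> 0"
      using M_lim(1)[of "int l + 1"] by (simp add: algebra_simps)
    show "(\<lambda>n. M (int l - 1 - (int l + int n) + 1)) \<longlonglongrightarrow> 0"
      using M_lim(2)[of 0] by simp
  qed
  then have "Z (int l) = 0"
    unfolding Z_const by (simp add: LIMSEQ_const_iff)
  then have "y (int l) * M (int l + 1) + y (- 1) * M 0 = 0"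
    by (simp add: Z_def P_def)
  moreover have y_neg: "\<mu> * y (- 1) = - c * y (int l)"
    using y[of 0] by simp
  moreover have "y (int l) * (\<mu> * M (int l + 1) - c * M 0) =
      \<mu> * (y (int l) * M (int l + 1) + y (- 1) * M 0) - (\<mu> * y (- 1) + c * y (int l)) * M 0"
    by (simp add: algebra_simps)
  ultimately have "y (int l) * (\<mu> * M (int l + 1) - c * M 0) = 0"
    by simp
  then have "y (int l) * (of_int (int l) * M (int l)) = 0"
    using M_rel[of "int l"] by simp
  \<comment> \<open>A zero of \<open>M\<close> at \<open>l\<close> would spread by
    \<open>M_rel\<close> to 1, l - 1, 2 and so on, until all indices from 1 to l are
    covered.\<close>
  moreover have "M (int l) \<noteq> 0"
  proof
    assume Ml: "M (int l) = 0"
    have "M (int n + 1) = 0 \<and> M (int l - int n) = 0" if "n < l" for n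
      using that
    proof (induction n)
      case 0
      then show ?case using M_rel[of 0] Ml \<open>0 < \<mu>\<close> by simp
    next
      case (Suc n)
      then have IH: "M (int n + 1) = 0" "M (int l - int n) = 0" by auto
      have "of_int (int l - int n - 1) * M (int l - int n - 1) = 0"
        using M_rel[of "int l - int n - 1"] IH by simp
      moreover have "of_int (int l - int n - 1) \<noteq> (0 :: real)"
        using Suc.prems by linarith
      ultimately have 1: "M (int l - int n - 1) = 0" by simp
      then have "M (int n + 1 + 1) = 0"
        using M_rel[of "int n + 1"] IH \<open>0 < \<mu>\<close> by (simp add: algebra_simps)
      then show ?case using 1 by (simp add: algebra_simps)
    qed
    have M0: "M n = 0" if "1 \<le> n" "n \<le> int l" for n
      using \<open>\<And>n. n < l \<Longrightarrow> _\<close>[of "nat (n - 1)"] that by (simp add: nat_less_iff)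
    have "s (int 0) * \<epsilon> (int 0) = 0"
    proof (rule bessel_toeplitz_injective[where v = "\<lambda>j. s (int j) * \<epsilon> (int j)" and t = \<mu> and l = l and j = 0])
      fix n assume n: "1 \<le> n" "n \<le> int l"
      have "(\<Sum>j<l. s (int j) * \<epsilon> (int j) * bessel (n - int j) \<mu>) = s n * M n"
        unfolding M_def sum_distrib_left
        by (intro sum.cong refl) (simp add: J_def s_def)
      then show "(\<Sum>j<l. s (int j) * \<epsilon> (int j) * bessel (n - int j) \<mu>) = 0"
        using M0[OF n] by simp
    qed (use assms in auto)
    then show False using pos[of 0] \<open>0 < l\<close> by (simp add: s_def)
  qed
  ultimately have yl: "y (int l) = 0" using \<open>0 < l\<close> by simp
  then have y_1: "y (- 1) = 0" using y_neg \<open>0 < \<mu>\<close> by simp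
  have proportional: "y k = y 0 / \<epsilon> 0 * \<epsilon> k" if "- 1 \<le> k" "k < int l" for k
  proof (rule three_term_proportional)
    show "\<mu> * of_int (k + 1) * \<epsilon> (k + 1) = (of_int k * of_int (int l - k) + \<mu>\<^sup>2 - c\<^sup>2) * \<epsilon> k
        - \<mu> * of_int (int l - k) * \<epsilon> (k - 1)" for k
      by (rule first_order_imp_three_term[OF rel]) simp
    show "\<mu> * of_int (k + 1) * y (k + 1) = (of_int k * of_int (int l - k) + \<mu>\<^sup>2 - c\<^sup>2) * y k
        - \<mu> * of_int (int l - k) * y (k - 1)" for k
      by (rule first_order_imp_three_term[OF y]) simp
  qed (use that y_1 out[of "-1"] pos[of 0] \<open>0 < l\<close> \<open>0 < \<mu>\<close> in auto)
  \<comment> \<open>The last relation decides: with \<open>- c\<close>, a multiple of the positive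
    vector \<open>\<epsilon>\<close> can satisfy it only if the factor is 0.\<close>
  have "\<mu> * y (int l - 1) = - c * y 0"
    using y[of "int l"] yl by simp
  then have "(y 0 / \<epsilon> 0) * (\<mu> * \<epsilon> (int l - 1) + c * \<epsilon> 0) = 0"
    using proportional[of "int l - 1"] pos[of 0] \<open>0 < l\<close> by (simp add: algebra_simps)
  moreover have "0 < \<mu> * \<epsilon> (int l - 1) + c * \<epsilon> 0"
    using pos[of 0] pos[of "int l - 1"] \<open>0 < l\<close> \<open>0 < \<mu>\<close> \<open>0 < c\<close> by (simp add: add_pos_pos)
  ultimately have zero: "y 0 / \<epsilon> 0 = 0" by simp
  have "y k = y 0 / \<epsilon> 0 * \<epsilon> k"
    using \<open>0 \<le> k\<close> \<open>k < int l\<close> by (intro proportional) auto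
  then show ?thesis by (simp only: zero mult_zero_left)
qed

text \<open>The linear system obtained from the equation on the circle: \<open>\<phi>\<close> is, up to an explicit phase,
  twice the argument of a solution \<open>r\<close>. The gauge is chosen such that \<open>r\<close> has constant
  coefficients in the Fourier basis when it comes from a Heun polynomial.\<close>
definition linear_system :: "nat \<Rightarrow> real \<Rightarrow> real \<Rightarrow> (real \<Rightarrow> complex) \<Rightarrow> bool" where
  "linear_system l c m r \<longleftrightarrow> (\<forall>t. (r has_vector_derivative
     \<i> * (of_real m * cis (- t) * r t + of_real c * cis (- (real l * t)) * cnj (r t))) (at t))"

lemma linear_system_Re_Im:
  assumes "linear_system l c m r"
  shows "((\<lambda>t. Re (r t)) has_real_derivative m * (Re (r t) * sin t - Im (r t) * cos t)
      + c * (cos (real l * t) * Im (r t) + sin (real l * t) * Re (r t))) (at t)"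
    and "((\<lambda>t. Im (r t)) has_real_derivative m * (Re (r t) * cos t + Im (r t) * sin t)
      + c * (cos (real l * t) * Re (r t) - sin (real l * t) * Im (r t))) (at t)"
proof -
  have r: "(r has_vector_derivative
     \<i> * (of_real m * cis (- t) * r t + of_real c * cis (- (real l * t)) * cnj (r t))) (at t)"
    using assms by (simp add: linear_system_def)
  show "((\<lambda>t. Re (r t)) has_real_derivative m * (Re (r t) * sin t - Im (r t) * cos t)
      + c * (cos (real l * t) * Im (r t) + sin (real l * t) * Re (r t))) (at t)"
    using bounded_linear.has_vector_derivative[OF bounded_linear_Re r]
    by (simp add: has_real_derivative_iff_has_vector_derivative algebra_simps)
  show "((\<lambda>t. Im (r t)) has_real_derivative m * (Re (r t) * cos t + Im (r t) * sin t)
      + c * (cos (real l * t) * Re (r t) - sin (real l * t) * Im (r t))) (at t)"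
    using bounded_linear.has_vector_derivative[OF bounded_linear_Im r]
    by (simp add: has_real_derivative_iff_has_vector_derivative algebra_simps)
qed

text \<open>Liouville's formula: \<open>Im (cnj (q t) * r t)\<close> is the determinant of two
  solutions regarded as real plane vectors, and the trace of the system is
  \<open>2 * m * sin t\<close>, as the terms with \<open>c\<close> cancel.\<close>

lemma linear_system_wronskian:
  assumes q: "linear_system l c m q" and r: "linear_system l c m r"
  shows "Im (cnj (q t) * r t) * exp (2 * m * cos t) = Im (cnj (q s) * r s) * exp (2 * m * cos s)"
proof (rule DERIV_isconst_all[of "\<lambda>t. Im (cnj (q t) * r t) * exp (2 * m * cos t)"], rule allI)
  fix u
  have Im: "Im (cnj a * b) = Re a * Im b - Im a * Re b" for a b
    by simp
  define q1 where "q1 = (\<lambda>t. Re (q t))"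
  define q2 where "q2 = (\<lambda>t. Im (q t))"
  define r1 where "r1 = (\<lambda>t. Re (r t))"
  define r2 where "r2 = (\<lambda>t. Im (r t))"
  note dq = linear_system_Re_Im[OF q, of u, folded q1_def q2_def]
  note dr = linear_system_Re_Im[OF r, of u, folded r1_def r2_def]
  have "((\<lambda>t. exp (2 * m * cos t)) has_real_derivative exp (2 * m * cos u) * (2 * m * - sin u)) (at u)"
    by (auto intro!: derivative_eq_intros)
  note d = DERIV_mult[OF DERIV_diff[OF DERIV_mult[OF dq(1) dr(2)] DERIV_mult[OF dq(2) dr(1)]] this]
  have "((\<lambda>t. (q1 t * r2 t - q2 t * r1 t) * exp (2 * m * cos t)) has_real_derivative 0) (at u)"
    by (rule DERIV_cong[OF d]) (simp add: algebra_simps q1_def q2_def r1_def r2_def)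
  then show "((\<lambda>t. Im (cnj (q t) * r t) * exp (2 * m * cos t)) has_real_derivative 0) (at u)"
    unfolding Im by (simp add: q1_def q2_def r1_def r2_def)
qed

lemma josephson_imp_linear_system:
  assumes \<phi>: "josephson c (real l) m \<phi>"
  shows "\<exists>r R. linear_system l c m r \<and>
    (\<forall>t. 0 < R t \<and> r t = of_real (R t) * cis ((\<phi> t - real l * t) / 2 + pi / 4))"
proof -
  have "continuous_on UNIV (\<lambda>t. c * cos (\<phi> t))"
    by (intro continuous_intros josephson_continuous[OF \<phi>])
  then obtain \<rho> where \<rho>: "\<And>t. (\<rho> has_real_derivative c * cos (\<phi> t)) (at t)"
    using global_antiderivative by blast
  define u where "u = (\<lambda>t. \<rho> t - m * cos t)"
  define \<theta> where "\<theta> = (\<lambda>t. (\<phi> t - real l * t) / 2 + pi / 4)"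
  define r where "r = (\<lambda>t. exp (complex_of_real (u t) + \<i> * complex_of_real (\<theta> t)))"
  have r_polar: "r t = of_real (exp (u t)) * cis (\<theta> t)" for t
    by (simp add: r_def exp_add cis_conv_exp exp_of_real)
  have "(r has_vector_derivative
     \<i> * (of_real m * cis (- t) * r t + of_real c * cis (- (real l * t)) * cnj (r t))) (at t)" for t
  proof -
    define u' where "u' = c * cos (\<phi> t) + m * sin t"
    define \<theta>' where "\<theta>' = m * cos t - c * sin (\<phi> t)"
    have "(u has_real_derivative u') (at t)"
      unfolding u_def u'_def by (auto intro!: derivative_eq_intros \<rho>)
    moreover have "(\<theta> has_real_derivative \<theta>') (at t)"
      unfolding \<theta>_def \<theta>'_def
      by (auto intro!: derivative_eq_intros josephson_derivative[OF \<phi>] simp: field_simps)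
    ultimately have "((\<lambda>t. complex_of_real (u t) + \<i> * complex_of_real (\<theta> t)) has_vector_derivative
        of_real u' + \<i> * of_real \<theta>') (at t)"
      by (intro has_vector_derivative_add has_vector_derivative_mult_right has_vector_derivative_of_real)
        (simp_all add: has_real_derivative_iff_has_vector_derivative)
    from field_vector_diff_chain_at[OF this DERIV_exp]
    have "(r has_vector_derivative (of_real u' + \<i> * of_real \<theta>') * r t) (at t)"
      by (simp add: r_def o_def)
    moreover have "(of_real u' + \<i> * of_real \<theta>') * r t =
       \<i> * (of_real m * cis (- t) * r t + of_real c * cis (- (real l * t)) * cnj (r t))"
    proof -
      have "of_real u' + \<i> * of_real \<theta>' = \<i> * of_real m * cis (- t) + of_real c * cis (- \<phi> t)"
        by (simp add: complex_eq_iff u'_def \<theta>'_def)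
      \<comment> \<open>Twice the phase of \<open>r\<close> is
        \<open>\<phi> t - l * t + pi / 2\<close>, so the factor \<open>cis (- \<phi> t)\<close>
        reflects this phase. The offset pi/4 supplies the factor \<open>\<i>\<close>; it also makes
        \<open>r 0\<close> real for \<open>\<phi> 0 = - pi / 2\<close> and imaginary for
        \<open>\<phi> 0 = pi / 2\<close>.\<close>
      moreover have "cis (- \<phi> t) * cis (\<theta> t) = \<i> * cis (- (real l * t)) * cis (- \<theta> t)"
      proof -
        have "- \<phi> t + \<theta> t = pi / 2 + - (real l * t) + - \<theta> t"
          by (simp add: \<theta>_def field_simps)
        then have "cis (- \<phi> t + \<theta> t) = cis (pi / 2) * cis (- (real l * t)) * cis (- \<theta> t)"
          by (simp only: cis_mult)
        then show ?thesis by (simp only: cis_mult cis_pi_half)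
      qed
      ultimately show ?thesis
        unfolding r_polar by (simp add: algebra_simps cis_cnj)
    qed
    ultimately show ?thesis by simp
  qed
  then have "linear_system l c m r" by (simp add: linear_system_def)
  then show ?thesis
    using r_polar unfolding \<theta>_def by (intro exI[of _ r] exI[of _ "\<lambda>t. exp (u t)"]) auto
qed

section \<open>Heun polynomials and the periodicity of solutions\<close>

definition heun_polynomial :: "nat \<Rightarrow> (int \<Rightarrow> real) \<Rightarrow> real \<Rightarrow> complex" where
  "heun_polynomial l \<epsilon> t = (\<Sum>k<l. of_real (\<epsilon> (int k)) * cis (- (real k * t)))"

text \<open>Comparing the coefficients of \<open>cis (- (k * t))\<close> turns the system into the
  relation of \<open>heun_vector\<close>. Differentiation contributes \<open>- k\<close>, which is
  why the amplitude is \<open>- \<mu>\<close>.\<close>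

lemma heun_polynomial_linear_system:
  assumes \<epsilon>: "heun_vector l c \<mu> \<epsilon>"
  shows "linear_system l c (- \<mu>) (heun_polynomial l \<epsilon>)"
  unfolding linear_system_def
proof
  fix t
  define z where "z = (\<lambda>k::nat. cis (- (real k * t)))"
  have rel: "\<mu> * \<epsilon> (k - 1) = of_int k * \<epsilon> k + c * \<epsilon> (int l - k)" for k
    using \<epsilon> by (simp add: heun_vector_def)
  have out: "\<epsilon> k = 0" if "k < 0 \<or> int l \<le> k" for k
    using heun_vector_zero[OF \<epsilon> that] .
  have "((\<lambda>t. cis (- (real k * t))) has_vector_derivative - \<i> * of_real (real k) * z k) (at t)" for k
  proof -
    have "((\<lambda>t. - \<i> * of_real (real k) * of_real t) has_vector_derivative - \<i> * of_real (real k) * 1) (at t)"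
      by (intro has_vector_derivative_mult_right) (auto intro!: derivative_eq_intros)
    from field_vector_diff_chain_at[OF this DERIV_exp] show ?thesis
      by (simp add: o_def z_def cis_conv_exp mult.assoc)
  qed
  then have "(heun_polynomial l \<epsilon> has_vector_derivative
      (\<Sum>k<l. of_real (\<epsilon> (int k)) * (- \<i> * of_real (real k) * z k))) (at t)"
    unfolding heun_polynomial_def[abs_def]
    by (intro has_vector_derivative_sum has_vector_derivative_mult_right)
  moreover have "(\<Sum>k<l. of_real (\<epsilon> (int k)) * (- \<i> * of_real (real k) * z k)) =
      \<i> * (of_real (- \<mu>) * cis (- t) * heun_polynomial l \<epsilon> t
        + of_real c * cis (- (real l * t)) * cnj (heun_polynomial l \<epsilon> t))"
  proof -
    have 1: "of_real \<mu> * cis (- t) * heun_polynomial l \<epsilon> t = (\<Sum>k<Suc l. of_real (\<mu> * \<epsilon> (int k - 1)) * z k)"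
    proof -
      have "cis (- t) * cis (- (real k * t)) = z (Suc k)" for k
        by (simp add: z_def cis_mult algebra_simps)
      then show ?thesis
        unfolding sum.lessThan_Suc_shift heun_polynomial_def sum_distrib_left
        by (simp add: out) (intro sum.cong refl, simp add: algebra_simps)
    qed
    have 2: "of_real c * cis (- (real l * t)) * cnj (heun_polynomial l \<epsilon> t)
        = (\<Sum>k<Suc l. of_real (c * \<epsilon> (int l - int k)) * z k)"
    proof -
      have "of_real c * cis (- (real l * t)) * cnj (heun_polynomial l \<epsilon> t) =
          (\<Sum>k<l. of_real (c * \<epsilon> (int k)) * z (l - k))"
        unfolding heun_polynomial_def cnj_sum sum_distrib_left
        by (intro sum.cong refl) (simp add: z_def cis_cnj cis_mult of_nat_diff algebra_simps)
      also have "\<dots> = (\<Sum>k<Suc l. of_real (c * \<epsilon> (int k)) * z (l - k))"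
        by (simp add: out)
      also have "\<dots> = (\<Sum>k<Suc l. of_real (c * \<epsilon> (int l - int k)) * z k)"
        by (rule sum.reindex_bij_witness[of _ "\<lambda>j. l - j" "\<lambda>j. l - j"]) (auto simp: of_nat_diff)
      finally show ?thesis .
    qed
    have "(\<Sum>k<l. of_real (\<epsilon> (int k)) * (- \<i> * of_real (real k) * z k)) =
        (\<Sum>k<Suc l. of_real (\<epsilon> (int k)) * (- \<i> * of_real (real k) * z k))"
      by (simp add: out)
    also have "\<dots> = - \<i> * (\<Sum>k<Suc l. of_real (\<mu> * \<epsilon> (int k - 1)) * z k - of_real (c * \<epsilon> (int l - int k)) * z k)"
      unfolding sum_distrib_left rel
      by (intro sum.cong refl) (simp add: algebra_simps)
    also have "\<dots> = - \<i> * (of_real \<mu> * cis (- t) * heun_polynomial l \<epsilon> t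
        - of_real c * cis (- (real l * t)) * cnj (heun_polynomial l \<epsilon> t))"
      unfolding 1 2 sum_subtractf ..
    finally show ?thesis by (simp add: algebra_simps)
  qed
  ultimately show "(heun_polynomial l \<epsilon> has_vector_derivative
      \<i> * (of_real (- \<mu>) * cis (- t) * heun_polynomial l \<epsilon> t
        + of_real c * cis (- (real l * t)) * cnj (heun_polynomial l \<epsilon> t))) (at t)"
    by simp
qed

lemma heun_polynomial_at_0:
  assumes "heun_vector l c \<mu> \<epsilon>" "0 < l"
  shows "\<exists>E>0. heun_polynomial l \<epsilon> 0 = of_real E \<and> heun_polynomial l \<epsilon> (2 * pi) = of_real E"
proof -
  define E where "E = (\<Sum>k<l. \<epsilon> (int k))"
  have "0 < E"
    unfolding E_def using assms by (intro sum_pos) (auto simp: heun_vector_def)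
  moreover have "heun_polynomial l \<epsilon> 0 = of_real E"
    by (simp add: heun_polynomial_def E_def)
  moreover have "cis (- (real k * (2 * pi))) = 1" for k
    using cis_multiple_2pi[of "- real k"] by (simp add: mult.commute mult.left_commute)
  then have "heun_polynomial l \<epsilon> (2 * pi) = of_real E"
    by (simp add: heun_polynomial_def E_def)
  ultimately show ?thesis by blast
qed

text \<open>The polynomial and \<open>r\<close> are both real at time 0, so their Wronskian vanishes
  identically. The polynomial is real and nonzero at 2 pi, hence \<open>r\<close> is real there too;
  since its phase contains half of \<open>\<phi>\<close>, this fixes \<open>\<phi>\<close> modulo 2
  pi.\<close>

lemma heun_vector_imp_periodic:
  assumes \<epsilon>: "heun_vector l c \<mu> \<epsilon>" and "0 < l"
    and \<phi>: "josephson c (real l) (- \<mu>) \<phi>" and "\<phi> 0 = - pi / 2"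
  shows "\<exists>n::int. \<phi> (2 * pi) = \<phi> 0 + 2 * pi * of_int n"
proof -
  obtain r R where r: "linear_system l c (- \<mu>) r" "\<And>t. 0 < R t"
    and polar: "\<And>t. r t = of_real (R t) * cis ((\<phi> t - real l * t) / 2 + pi / 4)"
    using josephson_imp_linear_system[OF \<phi>] by blast
  obtain E where E: "0 < E" "heun_polynomial l \<epsilon> 0 = of_real E" "heun_polynomial l \<epsilon> (2 * pi) = of_real E"
    using heun_polynomial_at_0[OF \<epsilon> \<open>0 < l\<close>] by blast
  have "Im (r 0) = 0" by (simp add: polar \<open>\<phi> 0 = _\<close>)
  then have "Im (r (2 * pi)) = 0"
    using linear_system_wronskian[OF heun_polynomial_linear_system[OF \<epsilon>] r(1), of "2 * pi" 0] E by simp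
  then have "sin ((\<phi> (2 * pi) - real l * (2 * pi)) / 2 + pi / 4) = 0"
    using r(2)[of "2 * pi"] by (simp add: polar)
  then obtain n :: int where "(\<phi> (2 * pi) - real l * (2 * pi)) / 2 + pi / 4 = of_int n * pi"
    unfolding sin_zero_iff_int2 by blast
  then have "\<phi> (2 * pi) = \<phi> 0 + 2 * pi * of_int (n + int l)"
    using \<open>\<phi> 0 = _\<close> by (simp add: field_simps)
  then show ?thesis by blast
qed

text \<open>The relation is the integral over one period of the derivative of
  \<open>r t * cis (k * t)\<close>, whose boundary terms cancel by periodicity.\<close>

lemma linear_system_fourier:
  assumes r: "linear_system l c m r" and per: "r (2 * pi) = r 0"
  defines "I \<equiv> \<lambda>k::int. integral {0..2 * pi} (\<lambda>t. r t * cis (of_int k * t))"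
  shows "of_real m * I (k - 1) + of_real c * cnj (I (int l - k)) + of_int k * I k = 0"
    and "((\<lambda>t. r t * cis (of_int k * t)) has_integral I k) {0..2 * pi}"
    and "\<exists>C. \<forall>k. norm (I k) \<le> C"
proof -
  have d: "(r has_vector_derivative
     \<i> * (of_real m * cis (- t) * r t + of_real c * cis (- (real l * t)) * cnj (r t))) (at t)" for t
    using r by (simp add: linear_system_def)
  have "continuous (at t) r" for t
    using d by (rule has_vector_derivative_continuous)
  then have cont: "continuous_on S r" for S
    by (simp add: continuous_at_imp_continuous_on)
  have cis_cont: "continuous_on S (\<lambda>t. cis (of_int k * t))" for S and k :: int
    by (intro continuous_intros)
  show int: "((\<lambda>t. r t * cis (of_int k * t)) has_integral I k) {0..2 * pi}" for k
    unfolding I_def by (intro integrable_integral integrable_continuous_interval continuous_on_mult cont cis_cont)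
  have "bounded (r ` {0..2 * pi})"
    by (intro compact_imp_bounded compact_continuous_image cont) auto
  then obtain B where B: "\<And>t. t \<in> {0..2 * pi} \<Longrightarrow> norm (r t) \<le> B"
    unfolding bounded_iff by blast
  have "norm (I k) \<le> B * (2 * pi - 0)" for k
    unfolding I_def
  proof (rule integral_bound)
    show "continuous_on {0..2 * pi} (\<lambda>t. r t * cis (of_int k * t))"
      by (rule continuous_on_mult[OF cont cis_cont])
    show "norm (r t * cis (of_int k * t)) \<le> B" if "t \<in> {0..2 * pi}" for t
      using B[OF that] by (simp add: norm_mult)
  qed simp
  then show "\<exists>C. \<forall>k. norm (I k) \<le> C" by blast
  have dcis: "((\<lambda>t. cis (of_int k * t)) has_vector_derivative \<i> * of_int k * cis (of_int k * t)) (at t)" for t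
  proof -
    have "((\<lambda>t. \<i> * of_int k * of_real t) has_vector_derivative \<i> * of_int k * 1) (at t)"
      by (intro has_vector_derivative_mult_right) (auto intro!: derivative_eq_intros)
    from field_vector_diff_chain_at[OF this DERIV_exp] show ?thesis
      by (simp add: o_def cis_conv_exp mult.assoc)
  qed
  have ftc: "((\<lambda>t. r t * (\<i> * of_int k * cis (of_int k * t)) +
      \<i> * (of_real m * cis (- t) * r t + of_real c * cis (- (real l * t)) * cnj (r t)) * cis (of_int k * t))
      has_integral r (2 * pi) * cis (of_int k * (2 * pi)) - r 0 * cis (of_int k * 0)) {0..2 * pi}"
    by (rule fundamental_theorem_of_calculus[OF _ has_vector_derivative_at_within[OF has_vector_derivative_mult[OF d dcis]]]) simp
  have "cis (of_int k * (2 * pi)) = 1"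
    using cis_multiple_2pi[of "of_int k"] by (simp add: mult.commute mult.left_commute)
  then have boundary: "r (2 * pi) * cis (of_int k * (2 * pi)) - r 0 * cis (of_int k * 0) = 0"
    by (simp add: per)
  have integrand: "r t * (\<i> * of_int k * cis (of_int k * t)) +
      \<i> * (of_real m * cis (- t) * r t + of_real c * cis (- (real l * t)) * cnj (r t)) * cis (of_int k * t) =
      \<i> * (of_real m * (r t * cis (of_int (k - 1) * t)) + of_real c * cnj (r t * cis (of_int (int l - k) * t))
        + of_int k * (r t * cis (of_int k * t)))" for t
  proof -
    have e1: "cis (- t) * cis (of_int k * t) = cis (of_int (k - 1) * t)"
      by (simp add: cis_mult left_diff_distrib)
    have e2: "cis (- (real l * t)) * cis (of_int k * t) = cnj (cis (of_int (int l - k) * t))"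
      by (simp add: cis_mult cis_cnj left_diff_distrib)
    have "a * (\<i> * b * z) + \<i> * (m' * u * a + c' * v * w) * z =
        \<i> * (m' * (a * (u * z)) + c' * (w * (v * z)) + b * (a * z))" for a b c' m' u v w z :: complex
      by (simp add: algebra_simps)
    then show ?thesis unfolding e1[symmetric] complex_cnj_mult e2[symmetric] .
  qed
  note zero = ftc[unfolded boundary integrand]
  have cnj_int: "((\<lambda>t. cnj (r t * cis (of_int j * t))) has_integral cnj (I j)) {0..2 * pi}" for j
    using has_integral_linear[OF int bounded_linear_cnj, of j] by (simp add: o_def)
  have "((\<lambda>t. \<i> * (of_real m * (r t * cis (of_int (k - 1) * t))
        + of_real c * cnj (r t * cis (of_int (int l - k) * t))
        + of_int k * (r t * cis (of_int k * t)))) has_integral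
        \<i> * (of_real m * I (k - 1) + of_real c * cnj (I (int l - k)) + of_int k * I k)) {0..2 * pi}"
    by (intro has_integral_mult_right has_integral_add int cnj_int)
  from has_integral_unique[OF zero this]
  show "of_real m * I (k - 1) + of_real c * cnj (I (int l - k)) + of_int k * I k = 0"
    by simp
qed

text \<open>Conjugation reverses imaginary parts, so those of the Fourier coefficients satisfy the
  relation with \<open>- c\<close> and vanish from 0 to l - 1. No others contribute to the integral
  of \<open>Im (cnj h * r)\<close>, \<open>h\<close> being the polynomial, although this integrand
  is a positive constant times a positive exponential.\<close>

lemma heun_vector_second_solution_not_periodic:
  assumes \<epsilon>: "heun_vector l c \<mu> \<epsilon>" and "0 < l" "0 < c" "0 < \<mu>"
    and \<phi>: "josephson c (real l) (- \<mu>) \<phi>" and "\<phi> 0 = pi / 2"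
  shows "\<phi> (2 * pi) \<noteq> \<phi> 0 + 2 * pi * of_int n"
proof
  assume per: "\<phi> (2 * pi) = \<phi> 0 + 2 * pi * of_int n"
  obtain r R where r: "linear_system l c (- \<mu>) r" "\<And>t. 0 < R t"
    and polar: "\<And>t. r t = of_real (R t) * cis ((\<phi> t - real l * t) / 2 + pi / 4)"
    using josephson_imp_linear_system[OF \<phi>] by blast
  let ?h = "heun_polynomial l \<epsilon>"
  obtain E where E: "0 < E" "?h 0 = of_real E" "?h (2 * pi) = of_real E"
    using heun_polynomial_at_0[OF \<epsilon> \<open>0 < l\<close>] by blast
  note wronskian = linear_system_wronskian[OF heun_polynomial_linear_system[OF \<epsilon>] r(1)]
  have r0: "r 0 = of_real (R 0) * \<i>"
    by (simp add: polar \<open>\<phi> 0 = _\<close> cis_pi_half[symmetric] del: cis_pi_half)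
  have "(\<phi> (2 * pi) - real l * (2 * pi)) / 2 + pi / 4 = of_int (n - int l) * pi + pi / 2"
    using per \<open>\<phi> 0 = _\<close> by (simp add: field_simps)
  then have r1: "r (2 * pi) = of_real (R (2 * pi)) * (cis (of_int (n - int l) * pi) * \<i>)"
    unfolding polar by (simp only: cis_mult[symmetric] cis_pi_half)
  \<comment> \<open>A priori \<open>r\<close> could change its sign or modulus over a period. The
    Wronskian excludes both, as the polynomial and the weight take equal values at the two
    ends.\<close>
  have re: "Re (cis (of_int (n - int l) * pi)) * R (2 * pi) = R 0"
    using wronskian[of "2 * pi" 0] E unfolding r0 r1 by (simp add: mult.commute)
  have "Im (cis (of_int (n - int l) * pi)) = 0"
    using sin_int_2pin sin_npi_int[of "n - int l"] by (simp add: mult.commute del: of_int_diff)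
  then have "cis (of_int (n - int l) * pi) = of_real (Re (cis (of_int (n - int l) * pi)))"
    by (simp add: complex_eq_iff)
  then have "r (2 * pi) = r 0"
    unfolding r0 r1 using re by (metis mult.assoc mult.commute of_real_mult)
  note fourier = linear_system_fourier[OF r(1) this]
  define I where "I = (\<lambda>k::int. integral {0..2 * pi} (\<lambda>t. r t * cis (of_int k * t)))"
  define y where "y = (\<lambda>k. Im (I k))"
  obtain C where C: "\<And>k. norm (I k) \<le> C" using fourier(3) unfolding I_def by blast
  have "y k = 0" if "0 \<le> k" "k < int l" for k
  proof (rule bounded_anti_heun_sequence_vanishes[OF \<epsilon> \<open>0 < l\<close> \<open>0 < c\<close> \<open>0 < \<mu>\<close> _ _ that])
    fix k
    have "Im (of_real (- \<mu>) * I (k - 1) + of_real c * cnj (I (int l - k)) + of_int k * I k) = 0"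
      unfolding I_def fourier(1) by simp
    then show "\<mu> * y (k - 1) = of_int k * y k + - c * y (int l - k)"
      by (simp add: y_def)
    show "\<bar>y k\<bar> \<le> C" unfolding y_def using abs_Im_le_cmod C order_trans by blast
  qed
  then have "(\<Sum>k<l. \<epsilon> (int k) * y (int k)) = 0"
    by (intro sum.neutral) auto
  have "((\<lambda>t. \<Sum>k<l. of_real (\<epsilon> (int k)) * (r t * cis (of_int (int k) * t))) has_integral
      (\<Sum>k<l. of_real (\<epsilon> (int k)) * I (int k))) {0..2 * pi}"
    unfolding I_def by (intro has_integral_sum has_integral_mult_right fourier(2)) auto
  moreover have "(\<Sum>k<l. of_real (\<epsilon> (int k)) * (r t * cis (of_int (int k) * t))) = cnj (?h t) * r t" for t
    unfolding heun_polynomial_def cnj_sum sum_distrib_right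
    by (intro sum.cong refl) (simp add: cis_cnj mult_ac)
  ultimately have h_int: "((\<lambda>t. cnj (?h t) * r t) has_integral (\<Sum>k<l. of_real (\<epsilon> (int k)) * I (int k))) {0..2 * pi}"
    by simp
  have "Im (\<Sum>k<l. of_real (\<epsilon> (int k)) * I (int k)) = (\<Sum>k<l. \<epsilon> (int k) * y (int k))"
    by (simp add: y_def)
  with has_integral_linear[OF h_int bounded_linear_Im]
  have "((\<lambda>t. Im (cnj (?h t) * r t)) has_integral (\<Sum>k<l. \<epsilon> (int k) * y (int k))) {0..2 * pi}"
    by (simp only: o_def)
  then have zero: "((\<lambda>t. Im (cnj (?h t) * r t)) has_integral 0) {0..2 * pi}"
    using \<open>(\<Sum>k<l. \<epsilon> (int k) * y (int k)) = 0\<close> by simp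
  define K where "K = E * R 0 * exp (2 * - \<mu> * cos 0)"
  have K: "0 < K" using E r(2) by (simp add: K_def)
  have "Im (cnj (?h t) * r t) * exp (2 * - \<mu> * cos t) = K" for t
    using wronskian[of t 0] unfolding r0 E K_def by simp
  then have W: "K * exp (- (2 * \<mu>)) \<le> Im (cnj (?h t) * r t)" for t
  proof -
    have "Im (cnj (?h t) * r t) = K * exp (2 * \<mu> * cos t)"
      using \<open>Im (cnj (?h t) * r t) * exp (2 * - \<mu> * cos t) = K\<close>
      by (simp add: exp_minus field_simps)
    moreover have "2 * \<mu> * - 1 \<le> 2 * \<mu> * cos t"
      using \<open>0 < \<mu>\<close> by (intro mult_left_mono) auto
    ultimately show ?thesis using K by simp
  qed
  have "((\<lambda>t. K * exp (- (2 * \<mu>))) has_integral (2 * pi - 0) *\<^sub>R (K * exp (- (2 * \<mu>)))) {0..2 * pi}"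
    using has_integral_const_real[of "K * exp (- (2 * \<mu>))" 0 "2 * pi"] by simp
  from has_integral_le[OF this zero] W have "2 * pi * (K * exp (- (2 * \<mu>))) \<le> 0"
    by simp
  then show False using K pi_gt_zero by (simp add: mult_le_0_iff)
qed

section \<open>The intersections\<close>

text \<open>By \<open>heun_vector_compare\<close> the eigenvalue is nondecreasing in
  \<open>c\<close>, while its quotient by \<open>c\<close> is nonincreasing; together these squeeze
  it.\<close>

lemma heun_vector_family_continuous:
  assumes \<epsilon>: "\<And>c. 0 < c \<Longrightarrow> heun_vector l c (\<mu> c) (\<epsilon> c)" and "0 < l"
  shows "continuous_on {0<..} \<mu>"
  unfolding continuous_on
proof
  fix c :: real
  assume "c \<in> {0<..}"
  then have c: "0 < c" by simp
  have compare: "\<mu> x \<le> s * \<mu> y" if "0 < x" "0 < y" "x \<le> s * y" "1 \<le> s" for x y s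
    using heun_vector_compare[OF \<epsilon> \<epsilon>, of x y s] that \<open>0 < l\<close> by simp
  have bound: "\<bar>\<mu> x - \<mu> c\<bar> \<le> \<bar>x / c - 1\<bar> * \<mu> c" if "0 < x" for x
  proof (cases "c \<le> x")
    case True
    have "\<mu> c \<le> 1 * \<mu> x" using c that True by (intro compare) auto
    moreover have "\<mu> x \<le> x / c * \<mu> c" using c that True by (intro compare) auto
    moreover have "\<bar>x / c - 1\<bar> = x / c - 1" using c True by simp
    ultimately show ?thesis by (simp add: left_diff_distrib)
  next
    case False
    have "\<mu> x \<le> 1 * \<mu> c" using c that False by (intro compare) auto
    moreover have "\<mu> c \<le> c / x * \<mu> x" using c that False by (intro compare) auto
    then have "x / c * \<mu> c \<le> x / c * (c / x * \<mu> x)"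
      using c that by (intro mult_left_mono) auto
    then have "x / c * \<mu> c \<le> \<mu> x" using c that by simp
    moreover have "\<bar>x / c - 1\<bar> = 1 - x / c" using c that False by simp
    ultimately show ?thesis by (simp add: left_diff_distrib)
  qed
  have "((\<lambda>x. \<mu> x - \<mu> c) \<longlongrightarrow> 0) (at c within {0<..})"
  proof (rule Lim_null_comparison)
    show "\<forall>\<^sub>F x in at c within {0<..}. norm (\<mu> x - \<mu> c) \<le> \<bar>x / c - 1\<bar> * \<mu> c"
      unfolding eventually_at_filter using bound by (auto intro: always_eventually)
    have "((\<lambda>x. \<bar>x / c - 1\<bar> * \<mu> c) \<longlongrightarrow> \<bar>c / c - 1\<bar> * \<mu> c) (at c within {0<..})"
      using c by (intro tendsto_intros) auto
    then show "((\<lambda>x. \<bar>x / c - 1\<bar> * \<mu> c) \<longlongrightarrow> 0) (at c within {0<..})"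
      using c by simp
  qed
  then show "(\<mu> \<longlongrightarrow> \<mu> c) (at c within {0<..})" by (simp add: LIM_zero_iff)
qed

text \<open>The cosine forcing integrates to 0 over a period. The bound is therefore uniform in
  \<open>m\<close>, which itself varies with \<open>c\<close> along the Perron branch.\<close>

lemma josephson_small_coupling:
  assumes \<phi>: "josephson c b m \<phi>" and "0 \<le> c"
  shows "\<bar>\<phi> (2 * pi) - \<phi> 0 - 2 * pi * b\<bar> \<le> 4 * pi * c"
proof -
  define u where "u = (\<lambda>t. \<phi> t - b * t - 2 * m * sin t)"
  have u: "(u has_real_derivative - 2 * c * sin (\<phi> t)) (at t)" for t
    unfolding u_def by (auto intro!: derivative_eq_intros josephson_derivative[OF \<phi>])
  have s: "\<bar>2 * c * sin (\<phi> t)\<bar> \<le> 2 * c" for t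
    using mult_left_mono[OF abs_sin_le_one, of "2 * c" "\<phi> t"] \<open>0 \<le> c\<close> by (simp add: abs_mult)
  have "u 0 + 2 * c * 0 \<le> u (2 * pi) + 2 * c * (2 * pi)"
  proof (rule DERIV_nonneg_imp_nondecreasing[of 0 "2 * pi" "\<lambda>t. u t + 2 * c * t"], simp, intro exI conjI)
    fix t
    show "((\<lambda>t. u t + 2 * c * t) has_real_derivative - 2 * c * sin (\<phi> t) + 2 * c) (at t)"
      by (auto intro!: derivative_eq_intros u)
    show "0 \<le> - 2 * c * sin (\<phi> t) + 2 * c" using s[of t] by linarith
  qed
  moreover have "u (2 * pi) - 2 * c * (2 * pi) \<le> u 0 - 2 * c * 0"
  proof (rule DERIV_nonpos_imp_nonincreasing[of 0 "2 * pi" "\<lambda>t. u t - 2 * c * t"], simp, intro exI conjI)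
    fix t
    show "((\<lambda>t. u t - 2 * c * t) has_real_derivative - 2 * c * sin (\<phi> t) - 2 * c) (at t)"
      by (auto intro!: derivative_eq_intros u)
    show "- 2 * c * sin (\<phi> t) - 2 * c \<le> 0" using s[of t] by linarith
  qed
  ultimately show ?thesis by (simp add: u_def abs_le_iff algebra_simps)
qed

text \<open>The rotation number along the Perron branch is an integer depending continuously on \<open>c\<close>, and
  it tends to \<open>l\<close> as \<open>c \<rightarrow> 0\<close>.\<close>
lemma heun_vector_branch_rotation:
  assumes "0 < l" "0 < c"
  shows "\<exists>\<mu> \<epsilon>. 0 < \<mu> \<and> heun_vector l c \<mu> \<epsilon> \<and>
    josephson_flow c (real l) (- \<mu>) (- pi / 2) (2 * pi) = - pi / 2 + 2 * pi * real l"
proof -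
  have "\<forall>c. \<exists>\<mu> \<epsilon>. 0 < c \<longrightarrow> c \<le> \<mu> \<and> heun_vector l c \<mu> \<epsilon>"
    using heun_vector_exists \<open>0 < l\<close> by blast
  then obtain \<mu> \<epsilon> where \<epsilon>: "\<And>c. 0 < c \<Longrightarrow> c \<le> \<mu> c" "\<And>c. 0 < c \<Longrightarrow> heun_vector l c (\<mu> c) (\<epsilon> c)"
    by metis
  define D where "D = (\<lambda>c. (josephson_flow c (real l) (- \<mu> c) (- pi / 2) (2 * pi) + pi / 2) / (2 * pi))"
  have int: "\<exists>n::int. D c = of_int n" if "0 < c" for c
  proof -
    have "\<exists>n::int. josephson_flow c (real l) (- \<mu> c) (- pi / 2) (2 * pi)
        = josephson_flow c (real l) (- \<mu> c) (- pi / 2) 0 + 2 * pi * of_int n"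
      by (rule heun_vector_imp_periodic[OF \<epsilon>(2)[OF that] \<open>0 < l\<close> josephson_flow(1) josephson_flow(2)])
    then show ?thesis by (auto simp: D_def josephson_flow(2))
  qed
  have "continuous_on {0<..} D"
    unfolding D_def
    by (intro continuous_intros josephson_flow_continuous heun_vector_family_continuous[OF \<epsilon>(2) \<open>0 < l\<close>]) auto
  have "D constant_on {0<..}"
  proof (rule continuous_discrete_range_constant)
    fix x :: real assume "x \<in> {0<..}"
    then obtain m :: int where m: "D x = of_int m" using int[of x] by auto
    have "1 \<le> norm (D y - D x)" if y: "y \<in> {0<..}" "D y \<noteq> D x" for y
    proof -
      obtain n :: int where n: "D y = of_int n" using int[of y] y(1) by auto
      then have "1 \<le> \<bar>n - m\<bar>" using y(2) m by auto
      then have "(1 :: real) \<le> of_int \<bar>n - m\<bar>" by linarith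
      then show ?thesis by (simp add: m n)
    qed
    then show "\<exists>e>0. \<forall>y. y \<in> {0<..} \<and> D y \<noteq> D x \<longrightarrow> e \<le> norm (D y - D x)"
      by (intro exI[of _ 1]) auto
  qed (use \<open>continuous_on {0<..} D\<close> in auto)
  then have "D c = D (1 / 8)"
    using \<open>0 < c\<close> unfolding constant_on_def by force
  \<comment> \<open>At \<open>c = 1 / 8\<close> the deviation \<open>4 * pi * c\<close> is a quarter
    of a turn, so the integer \<open>D (1 / 8)\<close> differs from \<open>l\<close> by at most
    1/4.\<close>
  moreover have "D (1 / 8) = real l"
  proof -
    have "\<bar>josephson_flow (1 / 8) (real l) (- \<mu> (1 / 8)) (- pi / 2) (2 * pi) - - pi / 2 - 2 * pi * real l\<bar> \<le> 4 * pi * (1 / 8)"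
      using josephson_small_coupling[OF josephson_flow(1), of "1 / 8" "real l" "- \<mu> (1 / 8)" "- pi / 2"]
      by (simp add: josephson_flow(2))
    also have "josephson_flow (1 / 8) (real l) (- \<mu> (1 / 8)) (- pi / 2) (2 * pi) - - pi / 2 - 2 * pi * real l
        = 2 * pi * (D (1 / 8) - real l)"
      by (simp add: D_def field_simps)
    finally have "\<bar>D (1 / 8) - real l\<bar> \<le> 1 / 4"
      by (simp add: abs_mult)
    moreover obtain n :: int where "D (1 / 8) = of_int n" using int[of "1 / 8"] by auto
    ultimately have "\<bar>of_int (n - int l)\<bar> \<le> (1 / 4 :: real)" by simp
    then have "n = int l" by linarith
    then show ?thesis using \<open>D (1 / 8) = of_int n\<close> by simp
  qed
  ultimately have "josephson_flow c (real l) (- \<mu> c) (- pi / 2) (2 * pi) = - pi / 2 + 2 * pi * real l"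
    by (simp add: D_def field_simps)
  then show ?thesis using \<epsilon>[OF \<open>0 < c\<close>] \<open>0 < c\<close> by (intro exI[of _ "\<mu> c"] exI[of _ "\<epsilon> c"]) auto
qed

text \<open>The shift to positive amplitude moves the initial point to \<open>\<psi> (- pi)\<close>,
  which reflection and periodicity evaluate as -pi/2 - pi l. Hence the intersection lies on the
  minus component for even \<open>l\<close> and on the plus component for odd
  \<open>l\<close>.\<close>

lemma exists_simple_intersection:
  assumes "0 < l" "0 < \<omega>"
  shows "\<exists>p \<in> semiaxis \<omega> (int l). gen_simple_int \<omega> (int l) (int l) p"
proof -
  define c where "c = 1 / (2 * \<omega>)"
  have c: "0 < c" using assms by (simp add: c_def)
  obtain \<mu> \<epsilon> where \<mu>: "0 < \<mu>" and \<epsilon>: "heun_vector l c \<mu> \<epsilon>"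
    and flow: "josephson_flow c (real l) (- \<mu>) (- pi / 2) (2 * pi) = - pi / 2 + 2 * pi * real l"
    using heun_vector_branch_rotation[OF assms(1) c] by blast
  define A where "A = 2 * \<omega> * \<mu>"
  define B where "B = real l * \<omega>"
  have par: "1 / (2 * \<omega>) = c" "B / \<omega> = real l" "A / (2 * \<omega>) = \<mu>"
    using assms by (simp_all add: c_def A_def B_def)
  define \<psi> where "\<psi> = josephson_flow c (real l) (- \<mu>) (- pi / 2)"
  have \<psi>: "josephson c (real l) (- \<mu>) \<psi>" "\<psi> 0 = - pi / 2" "\<psi> (2 * pi) = \<psi> 0 + 2 * pi * of_int (int l)"
    unfolding \<psi>_def by (rule josephson_flow)+ (simp only: josephson_flow(2) flow of_int_of_nat_eq)
  have "\<psi> t = of_int (2 * (- 1) + 1) * pi - \<psi> (- t)" for t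
    by (rule josephson_unique[OF \<psi>(1) josephson_reflect[OF \<psi>(1)], of 0]) (simp add: \<psi>(2))
  from this[of pi] have "\<psi> pi + \<psi> (- pi) = - pi" by simp
  moreover have per: "\<psi> (t + 2 * pi) = \<psi> t + 2 * pi * of_int (int l)" for t
    by (rule josephson_periodic[OF \<psi>(1), of 0]) (use \<psi>(3) in simp)
  from per[of "- pi"] have "\<psi> pi = \<psi> (- pi) + 2 * pi * real l" by simp
  ultimately have start: "\<psi> (- pi) = - pi / 2 - pi * real l" by simp
  have shifted: "josephson (1 / (2 * \<omega>)) (B / \<omega>) (A / (2 * \<omega>)) (\<lambda>t. \<psi> (t + - pi) + 2 * pi * of_int k)" for k
    unfolding par using josephson_translate[OF josephson_shift_pi[OF \<psi>(1), of "- pi"]] by simp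
  have lock: "(B, A) \<in> phase_lock \<omega> (int l)" "poincare_fixes \<omega> B A (\<psi> (- pi) + 2 * pi * of_int k)" for k
  proof -
    have "\<psi> (2 * pi + - pi) + 2 * pi * of_int k = \<psi> (0 + - pi) + 2 * pi * of_int k + 2 * pi * of_int (int l)"
      using per[of "- pi"] by simp
    from periodic_solution_imp_phase_lock[OF \<open>0 < \<omega>\<close> shifted[of k] this]
    show "(B, A) \<in> phase_lock \<omega> (int l)" "poincare_fixes \<omega> B A (\<psi> (- pi) + 2 * pi * of_int k)"
      by simp_all
  qed
  have "(B, A) \<in> bdry \<omega> (int l)"
  proof (cases "even l")
    case True
    then obtain i where "l = 2 * i" by (rule evenE)
    then have "\<psi> (- pi) + 2 * pi * of_int (int i) = - pi / 2" by (simp add: start)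
    from lock(2)[of "int i", unfolded this] show ?thesis
      using lock(1) by (simp add: bdry_def bdry_minus_def)
  next
    case False
    then obtain i where "l = 2 * i + 1" by (rule oddE)
    then have "\<psi> (- pi) + 2 * pi * of_int (int i + 1) = pi / 2" by (simp add: start algebra_simps)
    from lock(2)[of "int i + 1", unfolded this] show ?thesis
      using lock(1) by (simp add: bdry_def bdry_plus_def)
  qed
  moreover have "\<not> poincare_is_id \<omega> B A"
  proof
    assume id: "poincare_is_id \<omega> B A"
    \<comment> \<open>At a constriction the shifted copy of \<open>\<eta>\<close> is periodic as
      well; undoing the shift makes \<open>\<eta>\<close> the second periodic solution that was
      excluded.\<close>
    define \<eta> where "\<eta> = josephson_flow c (real l) (- \<mu>) (pi / 2)"
    have \<eta>: "josephson c (real l) (- \<mu>) \<eta>" "\<eta> 0 = pi / 2"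
      unfolding \<eta>_def by (rule josephson_flow)+
    have \<eta>': "josephson c (real l) \<mu> (\<lambda>t. \<eta> (t + - pi))"
      using josephson_shift_pi[OF \<eta>(1), of "- pi"] by simp
    then have sol: "is_sol \<omega> B A (\<lambda>t. \<eta> (t + - pi))"
      using \<open>0 < \<omega>\<close> by (simp add: is_sol_iff_josephson par)
    obtain k where "poincare_lift \<omega> B A (\<eta> (0 + - pi)) = \<eta> (0 + - pi) + 2 * pi * of_int k"
      using id unfolding poincare_is_id_def poincare_fixes_def by blast
    then have "\<eta> (- pi + 2 * pi) = \<eta> (- pi) + 2 * pi * of_int k"
      using poincare_lift_eq[OF \<open>0 < \<omega>\<close> sol] by simp
    then have "\<eta> (0 + 2 * pi) = \<eta> 0 + 2 * pi * of_int k"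
      by (rule josephson_periodic[OF \<eta>(1)])
    then show False
      using heun_vector_second_solution_not_periodic[OF \<epsilon> assms(1) c \<mu> \<eta>] by simp
  qed
  moreover have "A \<ge> 0" using assms \<mu> by (simp add: A_def)
  ultimately have "(B, A) \<in> semiaxis \<omega> (int l)" "gen_simple_int \<omega> (int l) (int l) (B, A)"
    by (simp_all add: semiaxis_def gen_simple_int_def axis_def is_constriction_def B_def)
  then show ?thesis by blast
qed

text \<open>The constants \<open>a\<close> and \<open>pi - a\<close> are equilibria. A start at
  -pi/2 stays below \<open>a\<close>; a start at pi/2 is trapped between the two, where
  \<open>2 * c * sin (\<phi> t)\<close> is at least \<open>b\<close> and the solution
  decreases.\<close>

lemma josephson_zero_amplitude:
  assumes \<phi>: "josephson c b 0 \<phi>" and "0 \<le> b" "b < 2 * c"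
    and init: "\<phi> 0 = pi / 2 \<or> \<phi> 0 = - pi / 2"
  shows "\<phi> pi \<le> pi / 2"
proof -
  define a where "a = arcsin (b / (2 * c))"
  have c: "0 < c" using assms by simp
  have "0 \<le> b / (2 * c)" "b / (2 * c) \<le> 1" using assms c by simp_all
  then have bound: "- 1 \<le> b / (2 * c)" "b / (2 * c) \<le> 1" "0 \<le> b / (2 * c)" by linarith+
  then have sin_a: "sin a = b / (2 * c)" unfolding a_def by (intro sin_arcsin)
  have a: "0 \<le> a" "a \<le> pi / 2"
    using arcsin_le_arcsin[of 0 "b / (2 * c)"] arcsin_bounded[of "b / (2 * c)"] bound by (simp_all add: a_def)
  have "b + 2 * 0 * cos t - 2 * c * sin a = 0" for t
    using c by (simp add: sin_a)
  then have eq: "josephson c b 0 (\<lambda>t. a)" "josephson c b 0 (\<lambda>t. pi - a)"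
    unfolding josephson_def sin_pi_minus by simp_all
  show ?thesis
    using init
  proof
    assume "\<phi> 0 = - pi / 2"
    then have "\<phi> 0 \<le> a" using a pi_gt_zero by linarith
    then have "\<phi> pi \<le> a" by (rule josephson_mono[OF \<phi> eq(1)])
    then show ?thesis using a by simp
  next
    assume 0: "\<phi> 0 = pi / 2"
    have range: "a \<le> \<phi> t" "\<phi> t \<le> pi - a" for t
    proof -
      show "a \<le> \<phi> t"
        by (rule josephson_mono[OF eq(1) \<phi>]) (use a 0 in linarith)
      show "\<phi> t \<le> pi - a"
        by (rule josephson_mono[OF \<phi> eq(2)]) (use a 0 in linarith)
    qed
    have "\<phi> pi \<le> \<phi> 0"
    proof (rule DERIV_nonpos_imp_nonincreasing[OF pi_ge_zero], intro exI conjI)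
      fix t
      show "(\<phi> has_real_derivative b + 2 * 0 * cos t - 2 * c * sin (\<phi> t)) (at t)"
        by (rule josephson_derivative[OF \<phi>])
      have "sin a \<le> sin (\<phi> t)"
      proof (cases "\<phi> t \<le> pi / 2")
        case True
        then show ?thesis using range[of t] a by (intro sin_monotone_2pi_le) auto
      next
        case False
        then have "sin a \<le> sin (pi - \<phi> t)" using range[of t] a by (intro sin_monotone_2pi_le) auto
        then show ?thesis by simp
      qed
      then have "2 * c * sin a \<le> 2 * c * sin (\<phi> t)" using c by (intro mult_left_mono) auto
      moreover have "2 * c * sin a = b" using sin_a c by simp
      ultimately show "b + 2 * 0 * cos t - 2 * c * sin (\<phi> t) \<le> 0" by simp
    qed
    then show ?thesis using 0 by simp
  qed
qed

lemma exists_boundary_intersection: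
  assumes "0 < \<omega>" "real l * \<omega> < 1" "s < l"
    and x: "x = pi / 2 \<or> x = - pi / 2 \<and> 0 < s"
  shows "\<exists>p \<in> semiaxis \<omega> (int l). p \<in> phase_lock \<omega> (int s) \<and> poincare_fixes \<omega> (fst p) (snd p) x"
proof -
  define c where "c = 1 / (2 * \<omega>)"
  have c: "0 < c" "real l < 2 * c" using assms by (simp_all add: c_def field_simps)
  define f where "f = (\<lambda>m. josephson_flow c (real l) m x pi)"
  obtain m1 where m1: "0 \<le> m1" "\<And>\<phi>. josephson c (real l) m1 \<phi> \<Longrightarrow> \<phi> 0 + (real l - 1) * pi \<le> \<phi> pi"
    using josephson_large_amplitude[OF c(1)] by blast
  have "f 0 \<le> pi / 2"
    unfolding f_def
    by (rule josephson_zero_amplitude[OF josephson_flow(1)]) (use x c in \<open>simp_all add: josephson_flow(2)\<close>, blast)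
  \<comment> \<open>From -pi/2 the bound pi/2 is already an advance of pi, so there the target needs
    \<open>0 < s\<close>; from pi/2 even \<open>s = 0\<close> is reached, which gives part
    (3).\<close>
  also have "\<dots> \<le> x + pi * real s"
    using x
  proof
    assume "x = - pi / 2 \<and> 0 < s"
    then have "pi * 1 \<le> pi * real s" by (intro mult_left_mono) auto
    then show ?thesis using \<open>x = - pi / 2 \<and> 0 < s\<close> by simp
  qed simp
  finally have lower: "f 0 \<le> x + pi * real s" .
  \<comment> \<open>The strict inequality \<open>s < l\<close> absorbs the loss of pi in
    \<open>josephson_large_amplitude\<close>.\<close>
  have "pi * real s \<le> (real l - 1) * pi"
    unfolding mult.commute[of pi] using \<open>s < l\<close> by (intro mult_right_mono) auto
  moreover have "x + (real l - 1) * pi \<le> f m1"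
    using m1(2)[OF josephson_flow(1), of x] unfolding josephson_flow(2) f_def .
  ultimately have upper: "x + pi * real s \<le> f m1" by linarith
  have "continuous_on {0..m1} f"
    unfolding f_def by (intro josephson_flow_continuous continuous_intros) auto
  then obtain m where m: "0 \<le> m" "f m = x + pi * real s"
    using IVT'[where f = f, OF lower upper m1(1)] by blast
  define \<phi> where "\<phi> = josephson_flow c (real l) m x"
  have \<phi>: "josephson c (real l) m \<phi>" "\<phi> 0 = x" "\<phi> pi = \<phi> 0 + pi * of_int (int s)"
    unfolding \<phi>_def using m(2) by (simp_all add: josephson_flow f_def)
  obtain j :: int where "2 * \<phi> 0 = of_int (2 * j + 1) * pi"
  proof (cases "x = pi / 2")
    case True
    then show thesis using that[of 0] by (simp add: \<phi>(2))
  next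
    case False
    then have "x = - pi / 2" using x by blast
    then show thesis using that[of "- 1"] by (simp add: \<phi>(2))
  qed
  from josephson_half_period[OF \<phi>(1) this \<phi>(3)]
  have per: "\<phi> (2 * pi) = \<phi> 0 + 2 * pi * of_int (int s)" .
  have par: "1 / (2 * \<omega>) = c" "real l * \<omega> / \<omega> = real l" "2 * \<omega> * m / (2 * \<omega>) = m"
    using assms by (simp_all add: c_def)
  note lock = periodic_solution_imp_phase_lock[OF \<open>0 < \<omega>\<close> _ per,
      where B = "real l * \<omega>" and A = "2 * \<omega> * m", unfolded par, OF \<phi>(1), unfolded \<phi>(2)]
  show ?thesis
  proof (rule bexI)
    show "(real l * \<omega>, 2 * \<omega> * m) \<in> semiaxis \<omega> (int l)"
      using m assms by (simp add: semiaxis_def)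
    show "(real l * \<omega>, 2 * \<omega> * m) \<in> phase_lock \<omega> (int s) \<and>
        poincare_fixes \<omega> (fst (real l * \<omega>, 2 * \<omega> * m)) (snd (real l * \<omega>, 2 * \<omega> * m)) x"
      unfolding fst_conv snd_conv by (rule conjI[OF lock])
  qed
qed

theorem theorem1p18:
  shows "(\<forall>l::nat. l \<ge> 1 \<longrightarrow> (\<forall>\<omega>>0.
            (\<exists>p \<in> semiaxis \<omega> (int l). gen_simple_int \<omega> (int l) (int l) p)))
       \<and> (\<forall>l::nat. l \<ge> 3 \<longrightarrow> (\<exists>\<omega>0>0. \<forall>s::nat. \<forall>\<omega>.
            even (l - s) \<and> 0 < s \<and> s < l \<and> 0 < \<omega> \<and> \<omega> < \<omega>0 \<longrightarrow>
              semiaxis \<omega> (int l) \<inter> bdry_plus \<omega> (int s) \<noteq> {} \<and>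
              semiaxis \<omega> (int l) \<inter> bdry_minus \<omega> (int s) \<noteq> {}))
       \<and> (\<forall>l::nat. l \<ge> 2 \<longrightarrow> (\<exists>\<omega>0>0. \<forall>\<omega>. 0 < \<omega> \<and> \<omega> < \<omega>0 \<longrightarrow>
              bdry_plus \<omega> 0 \<inter> semiaxis \<omega> (int l) \<noteq> {}))"
proof (intro conjI allI impI)
  show "\<exists>p \<in> semiaxis \<omega> (int l). gen_simple_int \<omega> (int l) (int l) p" if "l \<ge> 1" "0 < \<omega>" for l \<omega>
    using exists_simple_intersection that by simp
next
  fix l :: nat
  assume l: "l \<ge> 3"
  have plus: "semiaxis \<omega> (int l) \<inter> bdry_plus \<omega> (int s) \<noteq> {}"
    and minus: "semiaxis \<omega> (int l) \<inter> bdry_minus \<omega> (int s) \<noteq> {}"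
    if "0 < s" "s < l" "0 < \<omega>" "\<omega> < 1 / real l" for s \<omega>
  proof -
    have *: "real l * \<omega> < 1" using that l by (simp add: field_simps)
    show "semiaxis \<omega> (int l) \<inter> bdry_plus \<omega> (int s) \<noteq> {}"
      using exists_boundary_intersection[OF \<open>0 < \<omega>\<close> * \<open>s < l\<close>, of "pi / 2"] that
      by (auto simp: bdry_plus_def)
    show "semiaxis \<omega> (int l) \<inter> bdry_minus \<omega> (int s) \<noteq> {}"
      using exists_boundary_intersection[OF \<open>0 < \<omega>\<close> * \<open>s < l\<close>, of "- pi / 2"] that
      by (auto simp: bdry_minus_def)
  qed
  then show "\<exists>\<omega>0>0. \<forall>s::nat. \<forall>\<omega>.
      even (l - s) \<and> 0 < s \<and> s < l \<and> 0 < \<omega> \<and> \<omega> < \<omega>0 \<longrightarrow>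
        semiaxis \<omega> (int l) \<inter> bdry_plus \<omega> (int s) \<noteq> {} \<and>
        semiaxis \<omega> (int l) \<inter> bdry_minus \<omega> (int s) \<noteq> {}"
    using l by (intro exI[of _ "1 / real l"]) simp
next
  fix l :: nat
  assume l: "l \<ge> 2"
  have "bdry_plus \<omega> 0 \<inter> semiaxis \<omega> (int l) \<noteq> {}" if "0 < \<omega>" "\<omega> < 1 / real l" for \<omega>
  proof -
    have *: "real l * \<omega> < 1" using that l by (simp add: field_simps)
    show ?thesis
      using exists_boundary_intersection[OF \<open>0 < \<omega>\<close> *, of 0 "pi / 2"] l
      by (auto simp: bdry_plus_def)
  qed
  then show "\<exists>\<omega>0>0. \<forall>\<omega>. 0 < \<omega> \<and> \<omega> < \<omega>0 \<longrightarrow> bdry_plus \<omega> 0 \<inter> semiaxis \<omega> (int l) \<noteq> {}"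
    using l by (intro exI[of _ "1 / real l"]) simp
qed

end
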